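(* Let $k$ be a non-negative integer. For $|q|<1$, and for either choice of sign (upper signs throughout, or lower signs throughout), \begin{enumerate} \item[(i)] $\displaystyle \sum_{j=k}^\infty (\mp 1)^{j-k} \binom{2j}{j-k} V^{\pm}_{j}(q) = \frac{(\pm q;q)^2_\infty}{(q;q)^2_\infty} \left(-1+(1+q^k) \sum_{j=k}^\infty (-1)^{j-k}\,q^{j(j+1)/2-k(k+1)/2}\right)$; \item[(ii)] $\displaystyle \sum_{j=k}^\infty (\mp 1)^{j-k} \binom{2j}{j-k} W^{\pm}_{j}(q) = \frac{(\pm q;q^2)^2_\infty}{(q^2;q^2)^2_\infty}\sum_{j=k}^\infty (-1)^{j-k}\,q^{j(j+1)-k^2}$. \end{enumerate}
   Context: For $n\ge0$, $(a;q)_n=\prod_{r=0}^{n-1}(1-aq^r)$, and $(a;q)_\infty=\lim_{n\to\infty}(a;q)_n$ for $|q|<1$. For a non-negative integer $k$ define $$V^{\pm}_{k}(q)=\sum_{1\le n_1\le n_2\le\cdots\le n_k}\prod_{i=1}^k\frac{q^{n_i}}{(1\mp q^{n_i})^2},\qquad W^{\pm}_{k}(q)=\sum_{1\le n_1\le n_2\le\cdots\le n_k}\prod_{i=1}^k\frac{q^{2n_i-1}}{(1\mp q^{2n_i-1})^2},$$ with $V^{\pm}_0(q)=W^{\pm}_0(q)=1$.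
   Formalization: The left-hand series can diverge for |q|<1 (e.g. upper sign, 3-2√2<q<1), so each identity is stated for every complex |q|<1 at which its left-hand series converges; convergence is shown for |q|<3-2√2, and both identities are also proved unconditionally as formal power series in q. *)

theory Defs
  imports
    "HOL-Analysis.Analysis"
    "HOL-Computational_Algebra.Formal_Power_Series"
begin

text \<open>
  All definitions are polymorphic, so that they can be instantiated both with a complex number
  \<open>q\<close> and with the formal variable \<open>q = fps_X\<close>; in the latter case limits and infinite sums are
  those of the \<open>X\<close>-adic topology on formal power series.  The sign \<open>s\<close> is \<open>1\<close> for the upper and
  \<open>-1\<close> for the lower choice of signs: \<open>\<plusminus>\<close> is \<open>s\<close> and \<open>\<minusplus>\<close> is \<open>-s\<close>.
\<close>

definition qpoch :: "'a::comm_ring_1 \<Rightarrow> 'a \<Rightarrow> nat \<Rightarrow> 'a" where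
  "qpoch a q n = (\<Prod>r<n. 1 - a * q ^ r)"

definition qpoch_inf :: "'a::{comm_ring_1,t2_space} \<Rightarrow> 'a \<Rightarrow> 'a" where
  "qpoch_inf a q = lim (\<lambda>n. qpoch a q n)"

definition mono_tuples :: "nat \<Rightarrow> nat list set" where
  "mono_tuples k = {ns. length ns = k \<and> sorted ns \<and> (\<forall>n\<in>set ns. 1 \<le> n)}"

definition V :: "int \<Rightarrow> nat \<Rightarrow> 'a::{comm_ring_1,inverse,t2_space} \<Rightarrow> 'a" where
  "V s k q = (\<Sum>\<^sub>\<infinity>ns\<in>mono_tuples k. \<Prod>n\<leftarrow>ns. q ^ n / (1 - of_int s * q ^ n) ^ 2)"

definition W :: "int \<Rightarrow> nat \<Rightarrow> 'a::{comm_ring_1,inverse,t2_space} \<Rightarrow> 'a" where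
  "W s k q = (\<Sum>\<^sub>\<infinity>ns\<in>mono_tuples k.
     \<Prod>n\<leftarrow>ns. q ^ (2 * n - 1) / (1 - of_int s * q ^ (2 * n - 1)) ^ 2)"

definition V_term :: "int \<Rightarrow> nat \<Rightarrow> 'a::{comm_ring_1,inverse,t2_space} \<Rightarrow> nat \<Rightarrow> 'a" where
  "V_term s k q j = of_int (- s) ^ (j - k) * of_nat ((2 * j) choose (j - k)) * V s j q"

definition W_term :: "int \<Rightarrow> nat \<Rightarrow> 'a::{comm_ring_1,inverse,t2_space} \<Rightarrow> nat \<Rightarrow> 'a" where
  "W_term s k q j = of_int (- s) ^ (j - k) * of_nat ((2 * j) choose (j - k)) * W s j q"

text \<open>A series \<open>\<Sum>j=k..\<infinity>\<close> is indexed by \<open>i\<close> with \<open>j = k + i\<close>.\<close>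

definition V_rhs :: "int \<Rightarrow> nat \<Rightarrow> 'a::{comm_ring_1,inverse,t2_space} \<Rightarrow> 'a" where
  "V_rhs s k q =
     qpoch_inf (of_int s * q) q ^ 2 / qpoch_inf q q ^ 2 *
     (- 1 + (1 + q ^ k) *
       (\<Sum>i. let j = k + i in
          (- 1) ^ (j - k) * q ^ (j * (j + 1) div 2 - k * (k + 1) div 2)))"

definition W_rhs :: "int \<Rightarrow> nat \<Rightarrow> 'a::{comm_ring_1,inverse,t2_space} \<Rightarrow> 'a" where
  "W_rhs s k q =
     qpoch_inf (of_int s * q) (q ^ 2) ^ 2 / qpoch_inf (q ^ 2) (q ^ 2) ^ 2 *
     (\<Sum>i. let j = k + i in (- 1) ^ (j - k) * q ^ (j * (j + 1) - k ^ 2))"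

end

theory Submission
  imports Defs
begin

text \<open>
  With \<open>y\<^sub>i = q\<^sup>i\<close> or \<open>q\<^sup>2\<^sup>i\<^sup>-\<^sup>1\<close> and \<open>a\<^sub>i = y\<^sub>i / (1 \<minusplus> y\<^sub>i)\<^sup>2\<close>,
  the sums \<open>V\<^sub>j\<close>, \<open>W\<^sub>j\<close> are the complete homogeneous symmetric functions of the \<open>a\<^sub>i\<close>.
  Partial fractions give \<open>V\<^sub>j = \<Sum>\<^sub>m C\<^sub>m a\<^sub>m\<^sup>j\<close>, where \<open>C\<^sub>m\<close> is an
  explicit product because \<open>1 - a\<^sub>i / a\<^sub>m\<close> factors as
  \<open>(1 - y\<^sub>i / y\<^sub>m) (1 - y\<^sub>i y\<^sub>m) / (1 \<minusplus> y\<^sub>i)\<^sup>2\<close>. The numbers \<open>(\<minusplus>1)\<^sup>j\<^sup>-\<^sup>k (2j choose j-k)\<close> are the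
  coefficients of \<open>z\<^sup>k\<close> in \<open>(z + 1/z \<minusplus> 2)\<^sup>j\<close>, and summing them against \<open>a\<^sub>m\<^sup>j\<close> gives
  \<open>y\<^sub>m\<^sup>k (1 \<minusplus> y\<^sub>m)\<^sup>2 / (1 - y\<^sub>m\<^sup>2)\<close>; the sum over \<open>m\<close> is then the right-hand side.

  For complex \<open>q\<close> the double series need not converge absolutely. However,
  convergence of the series in \<open>j\<close> forces \<open>|a\<^sub>m| \<le> 1/4\<close> for all \<open>m\<close>, so that Abel summation applies;
  the limit exists because \<open>a = y / (1 \<minusplus> y)\<^sup>2\<close> is inverted by a square root of \<open>1 \<plusminus> 4 a\<close>, which is
  continuous at each \<open>a\<^sub>m\<close>. The formal identity follows coefficientwise from the one for finitely
  many \<open>a\<^sub>i\<close>.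
\<close>

unbundle no vec_syntax
unbundle fps_syntax

section \<open>Complete homogeneous symmetric functions and partial fractions\<close>

text \<open>Infinitely many weights are never manipulated directly: N of them are treated exactly,
  then N tends to infinity under a geometric majorant. The right-hand sides arise because C_m,
  multiplied by the value (1 - s y_m)^2 / (1 - y_m^2) that the sum over j leaves, is a quotient of
  q-Pochhammer products times a sign and q^(e m (m + 1) / 2). The number 1/4 is the radius of
  convergence in a, since the binomials grow like 4^j up to a power of j. All weights stay strictly
  inside when |q| / (1 - |q|)^2 < 1/4, that is |q| < 3 - 2 sqrt 2. For larger |q| a weight may lie
  on the circle |a| = 1/4, where the inner series is not absolutely convergent; this is the obstacle
  that the factor r^j, r < 1, removes. Partial fractions are not directly available for formal power
  series, because they divide by a_m - a_i, which is not a unit. The finite complex identity is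
  therefore put into a form whose denominators are units at q = 0 and carried over as an identity of
  Taylor series.\<close>

fun complete_hom :: "(nat \<Rightarrow> 'a::comm_ring_1) \<Rightarrow> nat \<Rightarrow> nat \<Rightarrow> 'a" where
  "complete_hom a N 0 = 1"
| "complete_hom a 0 (Suc j) = 0"
| "complete_hom a (Suc N) (Suc j) = complete_hom a N (Suc j) + a N * complete_hom a (Suc N) j"

definition pf_coeff :: "(nat \<Rightarrow> 'a::field) \<Rightarrow> nat \<Rightarrow> nat \<Rightarrow> 'a" where
  "pf_coeff a N m = (\<Prod>i\<in>{..<N} - {m}. a m / (a m - a i))"

lemma pf_coeff_Suc:
  assumes "m < N"
  shows "pf_coeff a (Suc N) m = pf_coeff a N m * (a m / (a m - a N))"
proof -
  have "{..<Suc N} - {m} = insert N ({..<N} - {m})" using assms by auto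
  then show ?thesis unfolding pf_coeff_def by (simp add: mult.commute)
qed

text \<open>General x is what drives the induction on N: the coefficient of the new pole is the
  product on the right at x = 1 / \<open>a N\<close>, so the induction hypothesis at that point
  expands it in the old coefficients. At x = 0 the coefficients sum to 1, which starts the induction
  on j below.\<close>

lemma partial_fractions:
  fixes a :: "nat \<Rightarrow> 'a::field"
  assumes inj: "inj a" and nz: "\<And>i. a i \<noteq> 0" and "N \<ge> 1" and "\<And>m. m < N \<Longrightarrow> x * a m \<noteq> 1"
  shows "(\<Sum>m<N. pf_coeff a N m / (1 - x * a m)) = (\<Prod>m<N. 1 / (1 - x * a m))"
  using assms(3,4)
proof (induction N arbitrary: x rule: dec_induct)
  case base
  then show ?case by (simp add: pf_coeff_def)
next
  case (step N)
  have ne: "a m \<noteq> a N" if "m < N" for m using inj that by (auto dest: injD)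
  have last: "pf_coeff a (Suc N) N = (\<Sum>m<N. pf_coeff a N m * (- a N / (a m - a N)))"
  proof -
    have "pf_coeff a (Suc N) N = (\<Prod>m<N. 1 / (1 - (1 / a N) * a m))"
    proof -
      have "{..<Suc N} - {N} = {..<N}" by auto
      moreover have "a N / (a N - a m) = 1 / (1 - (1 / a N) * a m)" if "m < N" for m
        using ne[OF that] nz[of N] by (auto simp: divide_simps)
      ultimately show ?thesis by (simp add: pf_coeff_def)
    qed
    also have "\<dots> = (\<Sum>m<N. pf_coeff a N m / (1 - (1 / a N) * a m))"
      by (subst step.IH) (use ne nz in \<open>auto simp: field_simps\<close>)
    also have "\<dots> = (\<Sum>m<N. pf_coeff a N m * (- a N / (a m - a N)))"
    proof (intro sum.cong refl)
      fix m assume "m \<in> {..<N}"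
      then have "a m - a N \<noteq> 0" "a N - a m \<noteq> 0" using ne[of m] by auto
      then show "pf_coeff a N m / (1 - (1 / a N) * a m) = pf_coeff a N m * (- a N / (a m - a N))"
        using nz[of N] by (simp add: divide_simps) (simp add: algebra_simps)
    qed
    finally show ?thesis .
  qed
  have xne: "1 - x * a m \<noteq> 0" if "m < Suc N" for m
    using step.prems[of m] that by simp
  have "(\<Sum>m<Suc N. pf_coeff a (Suc N) m / (1 - x * a m)) =
      (\<Sum>m<N. pf_coeff a N m * (a m / (a m - a N)) / (1 - x * a m))
      + (\<Sum>m<N. pf_coeff a N m * (- a N / (a m - a N))) / (1 - x * a N)"
    by (simp add: pf_coeff_Suc last)
  also have "\<dots> = (\<Sum>m<N. pf_coeff a N m * ((a m / (a m - a N)) / (1 - x * a m)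
       + (- a N / (a m - a N)) / (1 - x * a N)))"
    by (simp add: sum_divide_distrib flip: sum.distrib) (simp add: algebra_simps)
  also have "\<dots> = (\<Sum>m<N. pf_coeff a N m / (1 - x * a m) / (1 - x * a N))"
  proof (rule sum.cong[OF refl])
    fix m assume "m \<in> {..<N}"
    then have *: "a m - a N \<noteq> 0" "1 - x * a m \<noteq> 0" "1 - x * a N \<noteq> 0" using ne[of m] xne by auto
    have "(a m / (a m - a N)) / (1 - x * a m) + (- a N / (a m - a N)) / (1 - x * a N)
        = 1 / (1 - x * a m) / (1 - x * a N)"
      using * by (simp add: divide_simps) (simp add: algebra_simps)
    then show "pf_coeff a N m * ((a m / (a m - a N)) / (1 - x * a m)
       + (- a N / (a m - a N)) / (1 - x * a N)) = pf_coeff a N m / (1 - x * a m) / (1 - x * a N)"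
      by simp
  qed
  also have "\<dots> = (\<Prod>m<Suc N. 1 / (1 - x * a m))"
    using step.IH[of x] step.prems by (simp only: sum_divide_distrib[symmetric]) simp
  finally show ?case .
qed

text \<open>Both sides obey the last clause of \<open>complete_hom\<close>: multiplying the new
  coefficient by \<open>a m - a N\<close> trades the factor contributed by the new variable for one
  more power of \<open>a m\<close>, and it kills the term m = N.\<close>

lemma complete_hom_eq_sum_powers:
  fixes a :: "nat \<Rightarrow> 'a::field"
  assumes inj: "inj a" and nz: "\<And>i. a i \<noteq> 0" and "N \<ge> 1"
  shows "complete_hom a N j = (\<Sum>m<N. pf_coeff a N m * a m ^ j)"
  using assms(3)
proof (induction N arbitrary: j rule: dec_induct)
  case base
  have "complete_hom a 1 j = a 0 ^ j" by (induction j) auto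
  then show ?case by (simp add: pf_coeff_def)
next
  case (step N)
  show ?case
  proof (induction j)
    case 0
    show ?case using partial_fractions[OF inj nz, of "Suc N" 0] by simp
  next
    case (Suc j)
    have ne: "a m \<noteq> a N" if "m < N" for m using inj that by (auto dest: injD)
    have "(\<Sum>m<Suc N. pf_coeff a (Suc N) m * a m ^ Suc j)
         - a N * (\<Sum>m<Suc N. pf_coeff a (Suc N) m * a m ^ j)
        = (\<Sum>m<N. pf_coeff a (Suc N) m * a m ^ j * (a m - a N))"
      by (simp add: sum_distrib_left algebra_simps flip: sum_subtractf)
    also have "\<dots> = (\<Sum>m<N. pf_coeff a N m * a m ^ Suc j)"
      using ne by (intro sum.cong refl) (simp add: pf_coeff_Suc)
    also have "\<dots> = complete_hom a N (Suc j)" using step.IH by simp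
    finally show ?case by (simp add: Suc algebra_simps)
  qed
qed

section \<open>Nodes, weights and the closed form of the partial fraction coefficients\<close>

text \<open>\<open>e = 1\<close> is the case of \<open>V\<close> and \<open>e = 2\<close> that of \<open>W\<close>; the index \<open>i\<close> stands for \<open>n = i + 1\<close>.\<close>

definition node :: "nat \<Rightarrow> 'a::comm_ring_1 \<Rightarrow> nat \<Rightarrow> 'a" where
  "node e q i = q ^ (e * i + 1)"

definition weight :: "int \<Rightarrow> nat \<Rightarrow> 'a::{comm_ring_1,inverse} \<Rightarrow> nat \<Rightarrow> 'a" where
  "weight s e q i = node e q i / (1 - of_int s * node e q i) ^ 2"

text \<open>The sign and the triangular power come from the factors 1 - y_i / y_m with i < m. For e
  = 1 the extra factor is (q;q)_(m+1) / (q;q)_m: the products y_i y_m begin at q^(m+2), whereas the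
  factors with i < m supply only (q;q)_m.\<close>

definition kappa :: "nat \<Rightarrow> 'a::comm_ring_1 \<Rightarrow> nat \<Rightarrow> 'a" where
  "kappa e q m = (-1) ^ m * q ^ (e * (m * (m + 1) div 2)) * (if e = 1 then 1 - q ^ (m + 1) else 1)"

text \<open>For m < N this is \<open>pf_coeff\<close> times (1 - s y_m)^2 / (1 - y_m^2). Unlike
  \<open>pf_coeff\<close> it does not divide by powers of q, so its denominator is a unit for
  \<open>fps_X\<close>, and every Pochhammer product in it converges as N grows.\<close>

definition lcoeff :: "int \<Rightarrow> nat \<Rightarrow> nat \<Rightarrow> 'a::{comm_ring_1,inverse} \<Rightarrow> nat \<Rightarrow> 'a" where
  "lcoeff s e N q m = qpoch (of_int s * q) (q ^ e) N ^ 2 * kappa e q m /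
     (qpoch (q ^ e) (q ^ e) (N - 1 - m) * qpoch (q ^ e) (q ^ e) (N + m + 2 - e))"

lemma qpoch_add: "qpoch a q (m + n) = qpoch a q m * qpoch (a * q ^ m) q n"
  by (induction n) (auto simp: qpoch_def power_add algebra_simps)

text \<open>Each factor 1 - p^(-r) equals -p^(-r) (1 - p^r), and the exponents 1, ..., m add up to m
  (m + 1) / 2. The sign and the triangular exponent of the final series originate here.\<close>

lemma prod_inverse_powers:
  fixes p :: "'a::field"
  assumes "p \<noteq> 0"
  shows "(-1) ^ m * p ^ (m * (m + 1) div 2) * (\<Prod>i<m. 1 - 1 / p ^ (m - i)) = qpoch p p m"
proof (induction m)
  case 0
  then show ?case by (simp add: qpoch_def)
next
  case (Suc m)
  have ex: "Suc m * (Suc m + 1) div 2 = m * (m + 1) div 2 + Suc m"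
    by (simp add: algebra_simps)
  have "(\<Prod>i<Suc m. 1 - 1 / p ^ (Suc m - i)) = (1 - 1 / p ^ Suc m) * (\<Prod>i<m. 1 - 1 / p ^ (m - i))"
    by (subst prod.lessThan_Suc_shift) simp
  then have "(-1) ^ Suc m * p ^ (Suc m * (Suc m + 1) div 2) * (\<Prod>i<Suc m. 1 - 1 / p ^ (Suc m - i))
     = - (p ^ Suc m * (1 - 1 / p ^ Suc m)) *
       ((-1) ^ m * p ^ (m * (m + 1) div 2) * (\<Prod>i<m. 1 - 1 / p ^ (m - i)))"
    unfolding ex power_add by (simp only: power_Suc mult_ac) simp
  also have "- (p ^ Suc m * (1 - 1 / p ^ Suc m)) = 1 - p * p ^ m"
    using assms by (simp add: field_simps)
  finally show ?case unfolding Suc.IH by (simp add: qpoch_def mult.commute)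
qed

context
  fixes q :: "'a::field" and s :: int and e :: nat
  assumes q0: "q \<noteq> 0" and q1: "\<And>n. n \<ge> 1 \<Longrightarrow> q ^ n \<noteq> 1"
    and s: "s = 1 \<or> s = -1" and e: "e = 1 \<or> e = 2"
begin

lemma one_minus_node_nonzero: "1 - of_int s * node e q i \<noteq> 0"
proof
  assume "1 - of_int s * node e q i = 0"
  then have "node e q i ^ 2 = 1" using s
    by (auto simp: power2_eq_1_iff) (metis minus_minus)
  then have "q ^ (2 * (e * i + 1)) = 1"
    unfolding node_def by (simp only: power_mult[symmetric] mult.commute)
  then show False using q1[of "2 * (e * i + 1)"] by simp
qed

lemma weight_nonzero: "weight s e q i \<noteq> 0"
  using one_minus_node_nonzero[of i] q0 by (simp add: weight_def node_def)

text \<open>Because s^2 = 1, the map from y to y / (1 - s y)^2 is invariant under y -> 1 / y; as a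
  function of y_i the left side therefore vanishes at y_m and at 1 / y_m.\<close>

lemma one_minus_weight_quot:
  "1 - weight s e q i / weight s e q m
     = (1 - node e q i / node e q m) * (1 - node e q i * node e q m) / (1 - of_int s * node e q i) ^ 2"
proof -
  define y z where "y = node e q i" and "z = node e q m"
  have "z \<noteq> 0" using q0 by (simp add: z_def node_def)
  moreover have "1 - of_int s * y \<noteq> 0" "1 - of_int s * z \<noteq> 0"
    using one_minus_node_nonzero by (auto simp: y_def z_def)
  moreover have "(of_int s :: 'a) * of_int s = 1" using s by auto
  ultimately show ?thesis unfolding weight_def y_def[symmetric] z_def[symmetric]
    using s by (auto simp: divide_simps) (simp_all add: power2_eq_square algebra_simps)
qed

lemma node_quot_ge: "i \<ge> m \<Longrightarrow> node e q i / node e q m = (q ^ e) ^ (i - m)"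
  using q0 by (simp add: node_def power_diff power_mult)

lemma node_quot_le: "i \<le> m \<Longrightarrow> node e q i / node e q m = 1 / (q ^ e) ^ (m - i)"
  using q0 by (simp add: node_def power_diff power_mult)

lemma power_e_nonzero: "n \<ge> 1 \<Longrightarrow> (q ^ e) ^ n \<noteq> 1"
  using q1[of "e * n"] e by (auto simp: power_mult)

text \<open>With p = q^e the exponent of p is i + m + 2 for e = 1 and i + m + 1 for e = 2;
  \<open>3 - e\<close> merges the two.\<close>

lemma node_mult: "node e q i * node e q m = (q ^ e) ^ (i + m + 3 - e)"
  using e by (auto simp: node_def simp flip: power_add power_mult)

lemma node_quot_nonzero: "i \<noteq> m \<Longrightarrow> 1 - node e q i / node e q m \<noteq> 0"
proof (cases "i \<ge> m")
  case True
  assume "i \<noteq> m"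
  then show ?thesis using True power_e_nonzero[of "i - m"] by (simp add: node_quot_ge)
next
  case False
  then show ?thesis using power_e_nonzero[of "m - i"] by (simp add: node_quot_le divide_simps)
qed

lemma node_mult_nonzero: "1 - node e q i * node e q m \<noteq> 0"
  using power_e_nonzero[of "i + m + 3 - e"] e by (auto simp: node_mult)

lemma inj_weight: "inj (weight s e q)"
proof (rule injI, rule ccontr)
  fix i m assume *: "weight s e q i = weight s e q m" and "i \<noteq> m"
  then have "(1 - node e q i / node e q m) * (1 - node e q i * node e q m) = 0"
    using one_minus_weight_quot[of i m] weight_nonzero[of m] one_minus_node_nonzero[of i] by simp
  then show False using node_quot_nonzero[OF \<open>i \<noteq> m\<close>] node_mult_nonzero[of i m] by simp
qed

lemma qpoch_e_nonzero: "qpoch (q ^ e) (q ^ e) n \<noteq> 0"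
  unfolding qpoch_def using power_e_nonzero[of "Suc _"] by auto

text \<open>The product defining \<open>pf_coeff\<close> splits into A / (D B). The extra factor
  supplies exactly what is missing at i = m: (1 - s y_m)^2 completes A to a squared Pochhammer
  product, and 1 - y_m^2 completes B.\<close>

lemma pf_coeff_weight:
  assumes m: "m < N"
  shows "pf_coeff (weight s e q) N m * ((1 - of_int s * node e q m) ^ 2 / (1 - node e q m ^ 2))
     = lcoeff s e N q m"
proof -
  let ?y = "node e q" and ?p = "q ^ e"
  let ?I = "{..<N} - {m}"
  have split: "(\<Prod>i<N. f i) = f m * (\<Prod>i\<in>?I. f i)" for f :: "nat \<Rightarrow> 'a"
    using m by (intro prod.remove) auto
  define A where "A = (\<Prod>i\<in>?I. (1 - of_int s * ?y i) ^ 2)"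
  define B where "B = (\<Prod>i\<in>?I. 1 - ?y i * ?y m)"
  define D where "D = (\<Prod>i\<in>?I. 1 - ?y i / ?y m)"
  have "pf_coeff (weight s e q) N m =
     (\<Prod>i\<in>?I. (1 - of_int s * ?y i) ^ 2 / ((1 - ?y i / ?y m) * (1 - ?y i * ?y m)))"
    unfolding pf_coeff_def
  proof (rule prod.cong[OF refl])
    fix i assume "i \<in> ?I"
    have "weight s e q m / (weight s e q m - weight s e q i)
       = 1 / (1 - weight s e q i / weight s e q m)"
      using weight_nonzero[of m] by (auto simp: divide_simps)
    then show "weight s e q m / (weight s e q m - weight s e q i) =
       (1 - of_int s * ?y i) ^ 2 / ((1 - ?y i / ?y m) * (1 - ?y i * ?y m))"
      by (simp add: one_minus_weight_quot)
  qed
  then have pf: "pf_coeff (weight s e q) N m = A / (D * B)"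
    by (simp add: A_def B_def D_def prod_dividef prod.distrib)
  have qA: "qpoch (of_int s * q) ?p N ^ 2 = (1 - of_int s * ?y m) ^ 2 * A"
  proof -
    have "qpoch (of_int s * q) ?p N = (\<Prod>i<N. 1 - of_int s * ?y i)"
      unfolding qpoch_def node_def by (simp add: power_mult mult.assoc)
    then show ?thesis unfolding A_def
      by (simp add: split[of "\<lambda>i. 1 - of_int s * ?y i"] power_mult_distrib prod_power_distrib)
  qed
  \<comment> \<open>Completed by i = m, the product of the 1 - y_i y_m is a Pochhammer product
    starting at p^(m+3-e); the first m + 2 - e factors in front make it start at p.\<close>
  have qB: "qpoch ?p ?p (m + 2 - e) * ((1 - ?y m ^ 2) * B) = qpoch ?p ?p (N + m + 2 - e)"
  proof -
    have "(1 - ?y m ^ 2) * B = (\<Prod>i<N. 1 - ?y i * ?y m)"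
      unfolding B_def by (simp add: split[of "\<lambda>i. 1 - ?y i * ?y m"] power2_eq_square)
    also have "\<dots> = qpoch (?p * ?p ^ (m + 2 - e)) ?p N"
      unfolding qpoch_def node_mult using e
      by (intro prod.cong refl) (auto simp: power_add[symmetric] power_mult[symmetric] add.commute)
    finally show ?thesis using qpoch_add[of ?p ?p "m + 2 - e" N] e by (auto simp: add_ac)
  qed
  \<comment> \<open>In D the indices i < m give inverse powers of p, evaluated by
    \<open>prod_inverse_powers\<close>, and the indices i > m give (p;p)_(N-1-m).\<close>
  have qm: "kappa e q m * D * qpoch ?p ?p m = 
      qpoch ?p ?p (m + 2 - e) * qpoch ?p ?p m * qpoch ?p ?p (N - 1 - m)"
  proof -
    have I: "?I = {..<m} \<union> {Suc m..<N}" using m by auto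
    have "D = (\<Prod>i<m. 1 - ?y i / ?y m) * (\<Prod>i=Suc m..<N. 1 - ?y i / ?y m)"
      unfolding D_def I by (rule prod.union_disjoint) auto
    also have "(\<Prod>i<m. 1 - ?y i / ?y m) = (\<Prod>i<m. 1 - 1 / ?p ^ (m - i))"
      by (intro prod.cong refl) (simp add: node_quot_le)
    also have "(\<Prod>i=Suc m..<N. 1 - ?y i / ?y m) = (\<Prod>i=Suc m..<N. 1 - ?p ^ (i - m))"
      by (intro prod.cong refl) (simp add: node_quot_ge)
    also have "\<dots> = (\<Prod>i<N - 1 - m. 1 - ?p ^ Suc i)"
      by (rule prod.reindex_bij_witness[of _ "\<lambda>i. i + Suc m" "\<lambda>i. i - Suc m"])
         (auto simp flip: power_Suc simp: Suc_diff_Suc)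
    also have "\<dots> = qpoch ?p ?p (N - 1 - m)" by (simp add: qpoch_def)
    finally have D: "D = (\<Prod>i<m. 1 - 1 / ?p ^ (m - i)) * qpoch ?p ?p (N - 1 - m)" .
    have k: "kappa e q m = (-1) ^ m * ?p ^ (m * (m + 1) div 2) * (if e = 1 then 1 - q ^ (m + 1) else 1)"
      by (simp add: kappa_def power_mult)
    have "kappa e q m * D = ((-1) ^ m * ?p ^ (m * (m + 1) div 2) * (\<Prod>i<m. 1 - 1 / ?p ^ (m - i)))
        * (if e = 1 then 1 - q ^ (m + 1) else 1) * qpoch ?p ?p (N - 1 - m)"
      unfolding k D by (simp only: mult_ac)
    also have "\<dots> = qpoch ?p ?p m * (if e = 1 then 1 - q ^ (m + 1) else 1) * qpoch ?p ?p (N - 1 - m)"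
      by (subst prod_inverse_powers) (use q0 in auto)
    also have "qpoch ?p ?p m * (if e = 1 then 1 - q ^ (m + 1) else 1) = qpoch ?p ?p (m + 2 - e)"
      using e by (auto simp: qpoch_def)
    finally show ?thesis by simp
  qed
  have nz: "1 - ?y m ^ 2 \<noteq> 0" "D \<noteq> 0" "B \<noteq> 0" "(1 - of_int s * ?y m) \<noteq> 0"
    using node_mult_nonzero[of m m] node_mult_nonzero node_quot_nonzero one_minus_node_nonzero[of m]
    by (auto simp: D_def B_def power2_eq_square)
  have K: "kappa e q m = qpoch ?p ?p (m + 2 - e) * qpoch ?p ?p (N - 1 - m) / D"
    using qm qpoch_e_nonzero[of m] nz by (simp add: field_simps)
  have "A / (D * B) * (u / v) = u * A * (Q1 * Q2 / D) / (Q2 * (Q1 * (v * B)))"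
    if "Q1 \<noteq> 0" "Q2 \<noteq> 0" for Q1 Q2 u v :: 'a
    using that by (simp add: mult_ac)
  then show ?thesis unfolding pf lcoeff_def qA qB[symmetric] K
    using qpoch_e_nonzero[of "m + 2 - e"] qpoch_e_nonzero[of "N - 1 - m"] by blast
qed

end

section \<open>Sums over non-decreasing tuples as complete homogeneous sums\<close>

definition bounded_tuples :: "nat \<Rightarrow> nat \<Rightarrow> nat list set" where
  "bounded_tuples N k = {ns \<in> mono_tuples k. set ns \<subseteq> {..N}}"

lemma finite_bounded_tuples: "finite (bounded_tuples N k)"
  by (rule finite_subset[OF _ finite_lists_length_eq[of "{..N}" k]])
     (auto simp: bounded_tuples_def mono_tuples_def)

lemma bounded_tuples_subset: "bounded_tuples N k \<subseteq> mono_tuples k"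
  by (auto simp: bounded_tuples_def)

lemma finite_subset_bounded_tuples:
  assumes "finite X" "X \<subseteq> mono_tuples k"
  shows "\<exists>N0. \<forall>N\<ge>N0. X \<subseteq> bounded_tuples N k"
proof (intro exI allI impI)
  fix N assume N: "N \<ge> Max (insert 0 (\<Union>(set ` X)))"
  have "n \<le> N" if "ns \<in> X" "n \<in> set ns" for ns n
    by (rule order_trans[OF Max_ge N]) (use that assms in auto)
  then show "X \<subseteq> bounded_tuples N k" using assms(2) by (auto simp: bounded_tuples_def)
qed

text \<open>A non-decreasing tuple contains the largest admissible value exactly when it ends with
  it; the part in front may end with it again, so the bound is kept there. This matches the last
  clause of \<open>complete_hom\<close>.\<close>

lemma bounded_tuples_Suc:
  "bounded_tuples (Suc N) (Suc k)
     = bounded_tuples N (Suc k) \<union> (\<lambda>ns. ns @ [Suc N]) ` bounded_tuples (Suc N) k" (is "?L = ?R")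
proof
  show "?R \<subseteq> ?L"
    by (auto simp: bounded_tuples_def mono_tuples_def sorted_append)
  show "?L \<subseteq> ?R"
  proof
    fix ns assume ns: "ns \<in> ?L"
    then have "ns \<noteq> []" by (auto simp: bounded_tuples_def mono_tuples_def)
    define xs x where "xs = butlast ns" and "x = last ns"
    have eq: "ns = xs @ [x]" using \<open>ns \<noteq> []\<close> by (simp add: xs_def x_def)
    show "ns \<in> ?R"
    proof (cases "x = Suc N")
      case True
      then show ?thesis using ns unfolding eq
        by (auto simp: bounded_tuples_def mono_tuples_def sorted_append)
    next
      case False
      then have "x \<le> N" using ns by (auto simp: eq bounded_tuples_def)
      then have "ns \<in> bounded_tuples N (Suc k)" using ns unfolding eq
        by (fastforce simp: bounded_tuples_def mono_tuples_def sorted_append)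
      then show ?thesis by simp
    qed
  qed
qed

lemma sum_bounded_tuples:
  fixes f :: "nat \<Rightarrow> 'a::comm_ring_1"
  shows "(\<Sum>ns\<in>bounded_tuples N k. \<Prod>n\<leftarrow>ns. f n) = complete_hom (\<lambda>i. f (Suc i)) N k"
proof (induction "\<lambda>i. f (Suc i)" N k rule: complete_hom.induct)
  case (1 N)
  have "bounded_tuples N 0 = {[]}" by (auto simp: bounded_tuples_def mono_tuples_def)
  then show ?case by simp
next
  case (2 j)
  have "bounded_tuples 0 (Suc j) = {}"
    by (auto simp: bounded_tuples_def mono_tuples_def length_Suc_conv)
  then show ?case by simp
next
  case (3 N j)
  have "bounded_tuples N (Suc j) \<inter> (\<lambda>ns. ns @ [Suc N]) ` bounded_tuples (Suc N) j = {}"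
    by (auto simp: bounded_tuples_def)
  then have "(\<Sum>ns\<in>bounded_tuples (Suc N) (Suc j). \<Prod>n\<leftarrow>ns. f n) =
     (\<Sum>ns\<in>bounded_tuples N (Suc j). \<Prod>n\<leftarrow>ns. f n) +
     (\<Sum>ns\<in>(\<lambda>ns. ns @ [Suc N]) ` bounded_tuples (Suc N) j. \<Prod>n\<leftarrow>ns. f n)"
    unfolding bounded_tuples_Suc by (intro sum.union_disjoint) (auto simp: finite_bounded_tuples)
  also have "(\<Sum>ns\<in>(\<lambda>ns. ns @ [Suc N]) ` bounded_tuples (Suc N) j. \<Prod>n\<leftarrow>ns. f n)
      = f (Suc N) * (\<Sum>ns\<in>bounded_tuples (Suc N) j. \<Prod>n\<leftarrow>ns. f n)"
    by (subst sum.reindex) (auto simp: inj_on_def sum_distrib_left mult.commute)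
  finally show ?case using 3 by simp
qed

text \<open>Expanding the power produces every monomial of degree k at least once. Applied to norms,
  this bounds all finite tuple sums at once.\<close>

lemma complete_hom_le_power:
  fixes a :: "nat \<Rightarrow> real"
  assumes "\<And>i. a i \<ge> 0"
  shows "complete_hom a N k \<le> (\<Sum>i<N. a i) ^ k"
  using assms
proof (induction a N k rule: complete_hom.induct)
  case (3 a N j)
  have nn: "0 \<le> (\<Sum>i<N. a i)" using 3 by (simp add: sum_nonneg)
  have "complete_hom a N (Suc j) + a N * complete_hom a (Suc N) j
      \<le> (\<Sum>i<N. a i) ^ Suc j + a N * (\<Sum>i<Suc N. a i) ^ j"
    using 3 by (intro add_mono mult_left_mono) auto
  also have "\<dots> \<le> (\<Sum>i<N. a i) * (\<Sum>i<Suc N. a i) ^ j + a N * (\<Sum>i<Suc N. a i) ^ j"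
    using 3 nn by (auto intro!: mult_left_mono power_mono)
  finally show ?case by (simp add: algebra_simps)
qed auto

definition tuple_sum :: "int \<Rightarrow> nat \<Rightarrow> nat \<Rightarrow> 'a::{comm_ring_1,inverse,t2_space} \<Rightarrow> 'a" where
  "tuple_sum s e k q = (\<Sum>\<^sub>\<infinity>ns\<in>mono_tuples k. \<Prod>n\<leftarrow>ns. weight s e q (n - 1))"

lemma V_eq_tuple_sum: "V s k q = tuple_sum s 1 k q"
proof -
  have "n = 1 * (n - 1) + 1" if "n \<ge> 1" for n :: nat using that by simp
  then show ?thesis
    unfolding V_def tuple_sum_def weight_def node_def mono_tuples_def
    by (intro infsum_cong arg_cong[of _ _ prod_list] map_cong refl) (metis (lifting) mem_Collect_eq)
qed

lemma W_eq_tuple_sum: "W s k q = tuple_sum s 2 k q"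
proof -
  have "2 * n - 1 = 2 * (n - 1) + 1" if "n \<ge> 1" for n :: nat using that by simp
  then show ?thesis
    unfolding W_def tuple_sum_def weight_def node_def mono_tuples_def
    by (intro infsum_cong arg_cong[of _ _ prod_list] map_cong refl) (metis (lifting) mem_Collect_eq)
qed

text \<open>The boxes \<open>bounded_tuples N k\<close> are cofinal among the finite subsets, so the
  unordered sum may be evaluated along them.\<close>

lemma complete_hom_tendsto_tuple_sum:
  fixes q :: "'a::{comm_ring_1,inverse,t2_space}"
  assumes "(\<lambda>ns. \<Prod>n\<leftarrow>ns. weight s e q (n - 1)) summable_on mono_tuples k"
  shows "(\<lambda>N. complete_hom (weight s e q) N k) \<longlonglongrightarrow> tuple_sum s e k q"
proof -
  have "filterlim (\<lambda>N. bounded_tuples N k) (finite_subsets_at_top (mono_tuples k)) sequentially"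
    unfolding filterlim_finite_subsets_at_top eventually_sequentially
    using finite_subset_bounded_tuples finite_bounded_tuples bounded_tuples_subset by metis
  moreover have "(sum (\<lambda>ns. \<Prod>n\<leftarrow>ns. weight s e q (n - 1)) \<longlongrightarrow> tuple_sum s e k q)
       (finite_subsets_at_top (mono_tuples k))"
    using infsum_tendsto[OF assms] by (simp add: tuple_sum_def)
  ultimately have "(\<lambda>N. sum (\<lambda>ns. \<Prod>n\<leftarrow>ns. weight s e q (n - 1)) (bounded_tuples N k))
      \<longlonglongrightarrow> tuple_sum s e k q"
    by (rule filterlim_compose[rotated])
  then show ?thesis by (simp add: sum_bounded_tuples)
qed

lemma norm_prod_list: "norm (prod_list xs) = prod_list (map norm (xs :: 'a::real_normed_field list))"
  by (induction xs) (auto simp: norm_mult)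

lemma tuples_summable_on:
  fixes q :: complex
  assumes "summable (\<lambda>i. norm (weight s e q i))"
  shows "(\<lambda>ns. \<Prod>n\<leftarrow>ns. weight s e q (n - 1)) summable_on mono_tuples k"
proof (rule abs_summable_summable)
  let ?f = "\<lambda>ns. \<Prod>n\<leftarrow>ns. weight s e q (n - 1)"
  let ?S = "\<Sum>i. norm (weight s e q i)"
  show "(\<lambda>ns. norm (?f ns)) summable_on mono_tuples k"
    unfolding abs_summable_iff_bdd_above
  proof (rule bdd_aboveI2)
    fix X assume "X \<in> {F. F \<subseteq> mono_tuples k \<and> finite F}"
    then obtain N where N: "X \<subseteq> bounded_tuples N k"
      using finite_subset_bounded_tuples[of X k] by blast
    have "(\<Sum>ns\<in>X. norm (?f ns)) \<le> (\<Sum>ns\<in>bounded_tuples N k. norm (?f ns))"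
      by (rule sum_mono2[OF finite_bounded_tuples N]) auto
    also have "\<dots> = complete_hom (\<lambda>i. norm (weight s e q i)) N k"
      using sum_bounded_tuples[where f = "\<lambda>n. norm (weight s e q (n - 1))"]
      by (simp add: norm_prod_list comp_def)
    also have "\<dots> \<le> (\<Sum>i<N. norm (weight s e q i)) ^ k" by (rule complete_hom_le_power) simp
    also have "\<dots> \<le> ?S ^ k" by (intro power_mono sum_le_suminf assms) (auto intro: sum_nonneg)
    finally show "(\<Sum>ns\<in>X. norm (?f ns)) \<le> ?S ^ k" .
  qed
qed

section \<open>Interchange of limits and Abel summation\<close>

lemma tannery_dominated:
  fixes f :: "nat \<Rightarrow> 'b \<Rightarrow> complex"
  assumes lim: "\<And>m. (f m \<longlongrightarrow> l m) F"
    and bound: "\<forall>\<^sub>F x in F. \<forall>m. norm (f m x) \<le> M m"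
    and M: "summable M" and F: "F \<noteq> bot"
  shows "summable (\<lambda>m. norm (l m))" "((\<lambda>x. \<Sum>m. f m x) \<longlongrightarrow> suminf l) F"
proof -
  have "\<forall>\<^sub>F (m, x) in at_top \<times>\<^sub>F F. norm (f m x) \<le> M m"
    unfolding eventually_prod_filter using bound
    by (intro exI[of _ "\<lambda>_. True"] exI[of _ "\<lambda>x. \<forall>m. norm (f m x) \<le> M m"]) auto
  from tannerys_theorem[of f, OF lim this M F]
  show "summable (\<lambda>m. norm (l m))" "((\<lambda>x. \<Sum>m. f m x) \<longlongrightarrow> suminf l) F" by auto
qed

text \<open>Since the bound factorises, partial sums over j are dominated by \<open>M m\<close>
  times the total of g, uniformly in their length, and dominated convergence applies in m.\<close>

lemma suminf_swap_sums:
  fixes f :: "nat \<Rightarrow> nat \<Rightarrow> complex"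
  assumes bound: "\<And>m j. norm (f m j) \<le> M m * g j" and M: "summable M" and g: "summable g"
    and M0: "\<And>m. M m \<ge> 0" and g0: "\<And>j. g j \<ge> 0"
  shows "(\<lambda>j. \<Sum>m. f m j) sums (\<Sum>m. \<Sum>j. f m j)"
proof -
  have sj: "summable (f m)" for m
    by (rule summable_comparison_test'[OF summable_mult[OF g, of "M m"]]) (use bound in auto)
  have sm: "summable (\<lambda>m. f m j)" for j
    by (rule summable_comparison_test'[OF summable_mult2[OF M, of "g j"]]) (use bound in auto)
  have "norm (\<Sum>j<n. f m j) \<le> M m * suminf g" for m n
  proof -
    have "norm (\<Sum>j<n. f m j) \<le> (\<Sum>j<n. M m * g j)"
      using bound by (intro sum_norm_le) auto
    also have "\<dots> \<le> M m * suminf g"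
      unfolding sum_distrib_left[symmetric] by (intro mult_left_mono sum_le_suminf M0 g g0) auto
    finally show ?thesis .
  qed
  then have "(\<lambda>n. \<Sum>m. \<Sum>j<n. f m j) \<longlonglongrightarrow> (\<Sum>m. \<Sum>j. f m j)"
    by (intro tannery_dominated(2)[where M = "\<lambda>m. M m * suminf g"] summable_LIMSEQ sj
        summable_mult2 M) auto
  moreover have "(\<Sum>m. \<Sum>j<n. f m j) = (\<Sum>j<n. \<Sum>m. f m j)" for n
    using sm by (intro suminf_sum)
  ultimately show ?thesis unfolding sums_def by simp
qed

text \<open>Abel's theorem by summation by parts: the deviation from the sum is (1 - r) times the
  power series of the remainders T n, which tend to 0. The factor 1 - r makes the finitely many
  large remainders negligible and compensates 1 / (1 - r) from the tail.\<close>

lemma abel_limit: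
  fixes t :: "nat \<Rightarrow> complex"
  assumes t: "summable t"
  shows "((\<lambda>r. \<Sum>i. t i * of_real r ^ i) \<longlongrightarrow> suminf t) (at_left (1::real))"
proof -
  define T where "T = (\<lambda>n. (\<Sum>i<Suc n. t i) - suminf t)"
  have T0: "T \<longlonglongrightarrow> 0"
    unfolding T_def using LIMSEQ_Suc[OF summable_LIMSEQ[OF t]] by (simp add: LIM_zero_iff)
  then obtain B where B: "\<And>n. norm (T n) \<le> B" "B > 0"
    using Bseq_def[of T] convergent_imp_Bseq convergentI by metis
  have sT: "summable (\<lambda>n. norm (T n * of_real r ^ n))" if r: "0 < r" "r < 1" for r :: real
  proof (rule summable_comparison_test')
    show "summable (\<lambda>n. B * r ^ n)" using r by (intro summable_mult summable_geometric) auto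
    show "norm (norm (T n * of_real r ^ n)) \<le> B * r ^ n" for n
      using B(1)[of n] r by (auto simp: norm_mult norm_power intro: mult_right_mono)
  qed
  have eq: "(\<Sum>i. t i * of_real r ^ i) - suminf t = of_real (1 - r) * (\<Sum>n. T n * of_real r ^ n)"
    if r: "0 < r" "r < 1" for r :: real
  proof -
    have S: "summable (\<lambda>n. T n * of_real r ^ n)" using sT[OF r] by (rule summable_norm_cancel)
    then have "(\<lambda>n. of_real r * (T n * of_real r ^ n)) sums (of_real r * (\<Sum>n. T n * of_real r ^ n))"
      by (intro sums_mult summable_sums)
    then have "(\<lambda>n. T n * of_real r ^ Suc n) sums (of_real r * (\<Sum>n. T n * of_real r ^ n))"
      by (simp add: mult_ac)
    \<comment> \<open>T n - T (n - 1) = t n also at n = 0, provided that T (-1), the empty partial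
      sum minus the total, is read as \<open>- suminf t\<close>.\<close>
    then have "(\<lambda>n. case n of 0 \<Rightarrow> - suminf t | Suc n \<Rightarrow> T n * of_real r ^ Suc n) sums
       (of_real r * (\<Sum>n. T n * of_real r ^ n) + - suminf t)"
      using sums_Suc_iff[of "\<lambda>n. case n of 0 \<Rightarrow> - suminf t | Suc n \<Rightarrow> T n * of_real r ^ Suc n"] by simp
    from sums_diff[OF summable_sums[OF S] this]
    have "(\<lambda>n. T n * of_real r ^ n - (case n of 0 \<Rightarrow> - suminf t | Suc n \<Rightarrow> T n * of_real r ^ Suc n)) sums
       ((\<Sum>n. T n * of_real r ^ n) - (of_real r * (\<Sum>n. T n * of_real r ^ n) + - suminf t))" .
    also have "(\<lambda>n. T n * of_real r ^ n - (case n of 0 \<Rightarrow> - suminf t | Suc n \<Rightarrow> T n * of_real r ^ Suc n))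
       = (\<lambda>n. t n * of_real r ^ n)"
      by (auto simp: fun_eq_iff T_def algebra_simps split: nat.splits)
    finally show ?thesis by (simp add: sums_iff algebra_simps)
  qed
  have "((\<lambda>r. (\<Sum>i. t i * of_real r ^ i) - suminf t) \<longlongrightarrow> 0) (at_left (1::real))"
    unfolding tendsto_iff
  proof (intro allI impI)
    fix \<epsilon> :: real assume \<epsilon>: "\<epsilon> > 0"
    obtain N where N: "\<And>n. n \<ge> N \<Longrightarrow> norm (T n) < \<epsilon> / 2"
      using T0 \<epsilon> unfolding LIMSEQ_iff by (metis diff_zero half_gt_zero)
    have "((\<lambda>r. (1 - r) * (real N * B)) \<longlongrightarrow> (1 - 1) * (real N * B)) (at_left (1::real))"
      by (intro tendsto_intros)
    then have "\<forall>\<^sub>F r in at_left (1::real). (1 - r) * (real N * B) < \<epsilon> / 2"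
      using \<epsilon> by (intro order_tendstoD(2)) auto
    moreover have "\<forall>\<^sub>F r in at_left (1::real). r \<in> {0<..<1}"
      by (rule eventually_at_left_real) simp
    ultimately show "\<forall>\<^sub>F r in at_left 1. dist ((\<Sum>i. t i * of_real r ^ i) - suminf t) 0 < \<epsilon>"
    proof eventually_elim
      case (elim r)
      then have r: "0 < r" "r < 1" by auto
      have "norm (\<Sum>n. T n * of_real r ^ n) \<le> (\<Sum>n. norm (T n * of_real r ^ n))"
        by (rule summable_norm[OF sT[OF r]])
      also have "\<dots> = (\<Sum>n. norm (T (n + N) * of_real r ^ (n + N))) + (\<Sum>n<N. norm (T n * of_real r ^ n))"
        by (rule suminf_split_initial_segment[OF sT[OF r]])
      also have "(\<Sum>n<N. norm (T n * of_real r ^ n)) \<le> (\<Sum>n<N. B * 1)"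
        unfolding norm_mult norm_power using r
        by (intro sum_mono mult_mono B power_le_one) (auto intro: less_imp_le B)
      also have "(\<Sum>n. norm (T (n + N) * of_real r ^ (n + N))) \<le> (\<Sum>n. \<epsilon> / 2 * r ^ n)"
      proof (rule suminf_le)
        show "norm (T (n + N) * of_real r ^ (n + N)) \<le> \<epsilon> / 2 * r ^ n" for n
          unfolding norm_mult norm_power using r N[of "n + N"] \<epsilon>
          by (intro mult_mono) (auto intro: power_decreasing)
        show "summable (\<lambda>n. norm (T (n + N) * of_real r ^ (n + N)))"
          using sT[OF r] by (rule summable_ignore_initial_segment)
        show "summable (\<lambda>n. \<epsilon> / 2 * r ^ n)" using r by (intro summable_mult summable_geometric) auto
      qed
      also have "(\<Sum>n. \<epsilon> / 2 * r ^ n) = \<epsilon> / 2 * (1 / (1 - r))"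
        using r by (subst suminf_mult) (auto simp: suminf_geometric)
      finally have "norm (\<Sum>n. T n * of_real r ^ n) \<le> \<epsilon> / 2 * (1 / (1 - r)) + real N * B"
        by simp
      then have "(1 - r) * norm (\<Sum>n. T n * of_real r ^ n) \<le> (1 - r) * (\<epsilon> / 2 * (1 / (1 - r)) + real N * B)"
        using r by (intro mult_left_mono) auto
      also have "\<dots> = \<epsilon> / 2 + (1 - r) * (real N * B)" using r by (simp add: field_simps)
      also have "\<dots> < \<epsilon>" using elim by simp
      finally show ?case unfolding eq[OF r] dist_0_norm norm_mult dist_norm diff_zero norm_of_real using r by simp
    qed
  qed
  then show ?thesis by (simp add: LIM_zero_iff)
qed

section \<open>Generating functions of binomial coefficients\<close>

lemma binomial_le_4_power: "(2 * j) choose i \<le> 4 ^ j"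
proof -
  have "(2 * j) choose i \<le> 2 ^ (2 * j)"
  proof (cases "i \<le> 2 * j")
    case True
    then have "(2 * j) choose i \<le> (\<Sum>i\<le>2 * j. (2 * j) choose i)" by (intro member_le_sum) auto
    then show ?thesis by (simp add: choose_row_sum)
  qed (simp add: binomial_eq_0)
  then show ?thesis by (simp add: power_mult)
qed

text \<open>Up to a linear factor the binomial is as large as 4^i. This is the lower bound that
  turns convergence of the series in j into decay of V_j like 4^(-j), up to a factor linear in
  j.\<close>

lemma four_power_le_binomial: "4 ^ i \<le> (k + i + 1) * ((2 * (k + i)) choose i)"
proof (induction i)
  case (Suc i)
  define j where "j = k + i"
  define X where "X = (2 * j) choose i"
  define Y where "Y = (2 * Suc j) choose Suc i"
  have 1: "Suc i * Y = (2 * j + 2) * ((2 * j + 1) choose i)"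
    using Suc_times_binomial[of i "2 * j + 1"] by (simp add: Y_def)
  have 2: "(2 * k + i + 1) * ((2 * j + 1) choose i) = (2 * j + 1) * X"
    using binomial_absorb_comp[of "2 * j + 1" i] by (simp add: X_def j_def add.commute[of i])
  have 3: "Suc i * (2 * k + i + 1) * Y = (2 * j + 2) * (2 * j + 1) * X"
    using 1 2 by (metis mult.assoc mult.left_commute)
  \<comment> \<open>Arithmetic-geometric mean: the two factors add up to 2 (j + 1).\<close>
  have "Suc i * (2 * k + i + 1) \<le> (j + 1) ^ 2"
    by (simp add: j_def power2_eq_square algebra_simps)
  then have "(2 * j + 2) * (2 * j + 1) * X \<le> (j + 1) ^ 2 * Y"
    unfolding 3[symmetric] by (rule mult_right_mono) simp
  then have "(j + 1) * ((4 * j + 2) * X) \<le> (j + 1) * ((j + 1) * Y)"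
    by (simp add: power2_eq_square algebra_simps)
  then have 4: "(4 * j + 2) * X \<le> (j + 1) * Y" by (rule mult_left_le_imp_le) simp
  have "(j + 1) * (4 * ((j + 1) * X)) \<le> (j + 2) * ((4 * j + 2) * X)"
    by (simp add: algebra_simps)
  also have "\<dots> \<le> (j + 2) * ((j + 1) * Y)" using 4 by (rule mult_left_mono) simp
  finally have "(j + 1) * (4 * ((j + 1) * X)) \<le> (j + 1) * ((j + 2) * Y)" by (simp only: mult_ac)
  then have "4 * ((j + 1) * X) \<le> (j + 2) * Y" by (rule mult_left_le_imp_le) simp
  moreover have "4 ^ i \<le> (j + 1) * X" using Suc by (simp add: X_def j_def)
  ultimately have "4 ^ Suc i \<le> (j + 2) * Y" by simp
  then show ?case by (simp add: j_def Y_def)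
qed simp

text \<open>The value 0 for j < k lets the recurrences hold for all j and the generating function
  start at j = 0.\<close>

definition laurent_coeff :: "int \<Rightarrow> nat \<Rightarrow> nat \<Rightarrow> 'a::comm_ring_1" where
  "laurent_coeff s k j = (if k \<le> j then of_int (- s) ^ (j - k) * of_nat ((2 * j) choose (j - k)) else 0)"

lemma laurent_coeff_0: "laurent_coeff s k 0 = (if k = 0 then 1 else 0)"
  by (simp add: laurent_coeff_def)

text \<open>The constant term after one more factor z + 1/z - 2 s: the Laurent polynomial is
  symmetric under z -> 1/z, so z and 1/z contribute equally.\<close>

lemma laurent_coeff_0_Suc:
  assumes "s = 1 \<or> s = -1"
  shows "(laurent_coeff s 0 (Suc j) :: 'a::comm_ring_1)
    = 2 * laurent_coeff s 1 j - 2 * of_int s * laurent_coeff s 0 j"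
proof (cases j)
  case 0
  then show ?thesis by (simp add: laurent_coeff_def)
next
  case (Suc i)
  have 1: "(2 * Suc j) choose (Suc j) = (2 * j choose Suc j) + 2 * (2 * j choose j) + (2 * j choose i)"
    by (simp add: Suc)
  have 2: "(2 * j) choose (Suc j) = (2 * j) choose i"
    using binomial_symmetric[of i "2 * j"] Suc by simp
  show ?thesis using assms unfolding laurent_coeff_def diff_zero 1 2 by (auto simp: Suc algebra_simps)
qed

text \<open>The coefficient of z^(k+1) after one more factor z + 1/z - 2 s.\<close>

lemma laurent_coeff_Suc_Suc:
  assumes "s = 1 \<or> s = -1"
  shows "(laurent_coeff s (Suc k) (Suc j) :: 'a::comm_ring_1)
    = laurent_coeff s k j + laurent_coeff s (Suc (Suc k)) j - 2 * of_int s * laurent_coeff s (Suc k) j"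
proof -
  consider "j < k" | "j = k" | "j = Suc k" | d where "j = k + Suc (Suc d)"
    by (metis add_Suc_right less_imp_Suc_add linorder_neqE_nat not0_implies_Suc add_0_right)
  then show ?thesis
  proof cases
    case (4 d)
    have 1: "(2 * Suc j) choose Suc (Suc d)
        = (2 * j choose Suc (Suc d)) + 2 * (2 * j choose Suc d) + (2 * j choose d)"
      by simp
    have 2: "Suc j - Suc k = Suc (Suc d)" "j - k = Suc (Suc d)" "j - Suc k = Suc d" "j - Suc (Suc k) = d"
      "Suc k \<le> Suc j" "k \<le> j" "Suc k \<le> j" "Suc (Suc k) \<le> j"
      using 4 by auto
    show ?thesis unfolding laurent_coeff_def 2 1 using assms 2(5-) by (auto simp: algebra_simps)
  qed (use assms in \<open>auto simp: laurent_coeff_def\<close>)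
qed

text \<open>The recurrence amounts to (1 + y^2) \<phi>(k+1) = y (\<phi>(k) + \<phi>(k+2)), with
  characteristic roots y and 1/y. The defect \<phi>(k+1) - y \<phi>(k) isolates the root 1/y: it is
  y^n times the defect n steps later. Boundedness over the complex numbers, or divisibility by all
  powers of the variable for formal series, forces it to be 0; the boundary equation
  \<open>h0\<close> then fixes \<phi>(0).\<close>

lemma
  fixes \<phi> :: "nat \<Rightarrow> 'a::idom"
  assumes s: "s = 1 \<or> s = -1"
    and h0: "(1 - of_int s * y) ^ 2 * \<phi> 0 = (1 - of_int s * y) ^ 2 + y * (2 * \<phi> 1 - 2 * of_int s * \<phi> 0)"
    and hS: "\<And>k. (1 - of_int s * y) ^ 2 * \<phi> (Suc k) =
       y * (\<phi> k + \<phi> (Suc (Suc k)) - 2 * of_int s * \<phi> (Suc k))"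
  shows recurrence_shift: "\<phi> (Suc k) - y * \<phi> k = y ^ n * (\<phi> (Suc (k + n)) - y * \<phi> (k + n))"
    and recurrence_solution: "(\<And>k. \<phi> (Suc k) = y * \<phi> k) \<Longrightarrow>
       (1 - y ^ 2) * \<phi> k = y ^ k * (1 - of_int s * y) ^ 2"
proof -
  have step: "\<phi> (Suc k) - y * \<phi> k = y * (\<phi> (Suc (Suc k)) - y * \<phi> (Suc k))" for k
    using hS[of k] s by (auto simp: power2_eq_square algebra_simps)
  show "\<phi> (Suc k) - y * \<phi> k = y ^ n * (\<phi> (Suc (k + n)) - y * \<phi> (k + n))"
  proof (induction n)
    case (Suc n)
    then show ?case using step[of "k + n"] by simp
  qed simp
  assume geo: "\<And>k. \<phi> (Suc k) = y * \<phi> k"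
  have "(1 - y ^ 2) * \<phi> 0 = (1 - of_int s * y) ^ 2"
    using h0 s geo[of 0] by (auto simp: power2_eq_square algebra_simps)
  moreover have "\<phi> k = y ^ k * \<phi> 0" for k by (induction k) (auto simp: geo)
  ultimately show "(1 - y ^ 2) * \<phi> k = y ^ k * (1 - of_int s * y) ^ 2"
    by (metis mult.left_commute)
qed

lemma norm_laurent_coeff_le:
  assumes "s = 1 \<or> s = -1"
  shows "norm (laurent_coeff s k j :: complex) \<le> 4 ^ j"
proof -
  have "real ((2 * j) choose (j - k)) \<le> 4 ^ j"
    using binomial_le_4_power[of j "j - k"] by (metis of_nat_le_iff of_nat_numeral of_nat_power)
  then show ?thesis using assms by (auto simp: laurent_coeff_def norm_mult norm_power)
qed

lemma summable_laurent_coeff: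
  fixes b :: complex
  assumes s: "s = 1 \<or> s = -1" and b: "norm b < 1 / 4"
  shows "summable (\<lambda>j. laurent_coeff s k j * b ^ j)"
    and "norm (\<Sum>j. laurent_coeff s k j * b ^ j) \<le> 1 / (1 - 4 * norm b)"
proof -
  have bd: "norm (laurent_coeff s k j * b ^ j) \<le> (4 * norm b) ^ j" for j
    unfolding norm_mult norm_power power_mult_distrib
    by (intro mult_right_mono norm_laurent_coeff_le s) auto
  have g: "summable (\<lambda>j. (4 * norm b) ^ j)" using b by (intro summable_geometric) auto
  have sn: "summable (\<lambda>j. norm (laurent_coeff s k j * b ^ j))"
    by (rule summable_comparison_test'[OF g]) (use bd in auto)
  then show "summable (\<lambda>j. laurent_coeff s k j * b ^ j)" by (rule summable_norm_cancel)
  have "norm (\<Sum>j. laurent_coeff s k j * b ^ j) \<le> (\<Sum>j. norm (laurent_coeff s k j * b ^ j))"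
    by (rule summable_norm[OF sn])
  also have "\<dots> \<le> (\<Sum>j. (4 * norm b) ^ j)" by (intro suminf_le bd sn g)
  also have "\<dots> = 1 / (1 - 4 * norm b)" using b by (subst suminf_geometric) auto
  finally show "norm (\<Sum>j. laurent_coeff s k j * b ^ j) \<le> 1 / (1 - 4 * norm b)" .
qed

text \<open>As a sequence in k, the generating function inherits the recurrence of the coefficients.
  It is bounded in k by 1 / (1 - 4 |b|), so the defect is at most a constant times |y|^n for every n
  and vanishes.\<close>

lemma suminf_laurent_coeff:
  fixes y b :: complex
  assumes s: "s = 1 \<or> s = -1" and y: "norm y < 1" and b: "b = y / (1 - of_int s * y) ^ 2"
    and b4: "norm b < 1 / 4"
  shows "(\<Sum>j. laurent_coeff s k j * b ^ j) = y ^ k * (1 - of_int s * y) ^ 2 / (1 - y ^ 2)"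
proof -
  define \<phi> where "\<phi> = (\<lambda>k. \<Sum>j. laurent_coeff s k j * b ^ j)"
  note sm = summable_laurent_coeff(1)[OF s b4]
  have y2: "norm (y ^ 2) < 1" using y by (simp add: norm_power power_less_one_iff)
  have "norm (of_int s * y) < 1" using s y by (auto simp: norm_mult)
  then have nz: "1 - of_int s * y \<noteq> 0" "1 - y ^ 2 \<noteq> 0"
    using y2 by (metis eq_iff_diff_eq_0 norm_one less_irrefl)+
  have shift: "\<phi> k = laurent_coeff s k 0 + b * (\<Sum>j. laurent_coeff s k (Suc j) * b ^ j)" for k
  proof -
    have "\<phi> k = laurent_coeff s k 0 * b ^ 0 + (\<Sum>j. laurent_coeff s k (Suc j) * b ^ Suc j)"
      unfolding \<phi>_def using suminf_split_head[OF sm[of k]] by simp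
    also have "(\<Sum>j. laurent_coeff s k (Suc j) * b ^ Suc j) = (\<Sum>j. b * (laurent_coeff s k (Suc j) * b ^ j))"
      by (simp add: mult_ac)
    also have "\<dots> = b * (\<Sum>j. laurent_coeff s k (Suc j) * b ^ j)"
    \<comment> \<open>Summability of the shifted series comes from dividing by b.\<close>
    proof (cases "b = 0")
      case False
      have "summable (\<lambda>j. laurent_coeff s k (Suc j) * b ^ Suc j)" using sm[of k] by (subst summable_Suc_iff)
      then have "summable (\<lambda>j. laurent_coeff s k (Suc j) * b ^ Suc j * (1 / b))" by (rule summable_mult2)
      then have "summable (\<lambda>j. laurent_coeff s k (Suc j) * b ^ j)" using False by simp
      then show ?thesis by (rule suminf_mult)
    qed simp
    finally show ?thesis by simp
  qed
  have \<phi>0: "\<phi> 0 = 1 + b * (2 * \<phi> 1 - 2 * of_int s * \<phi> 0)"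
  proof -
    have "(\<lambda>j. laurent_coeff s 0 (Suc j) * b ^ j) sums (2 * \<phi> 1 - 2 * of_int s * \<phi> 0)"
      unfolding laurent_coeff_0_Suc[OF s] \<phi>_def left_diff_distrib mult.assoc
      by (intro sums_diff sums_mult summable_sums sm)
    then show ?thesis using shift[of 0] by (simp add: sums_iff laurent_coeff_0)
  qed
  have \<phi>S: "\<phi> (Suc k) = b * (\<phi> k + \<phi> (Suc (Suc k)) - 2 * of_int s * \<phi> (Suc k))" for k
  proof -
    have "(\<lambda>j. laurent_coeff s (Suc k) (Suc j) * b ^ j) sums
        (\<phi> k + \<phi> (Suc (Suc k)) - 2 * of_int s * \<phi> (Suc k))"
      unfolding laurent_coeff_Suc_Suc[OF s] \<phi>_def left_diff_distrib distrib_right mult.assoc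
      by (intro sums_diff sums_add sums_mult summable_sums sm)
    then show ?thesis using shift[of "Suc k"] by (simp add: sums_iff laurent_coeff_0)
  qed
  have yb: "(1 - of_int s * y) ^ 2 * b = y" using nz by (simp add: b)
  have h0: "(1 - of_int s * y) ^ 2 * \<phi> 0 = (1 - of_int s * y) ^ 2 + y * (2 * \<phi> 1 - 2 * of_int s * \<phi> 0)"
    by (subst \<phi>0) (simp only: distrib_left mult.assoc[symmetric] yb mult_1_right)
  have hS: "(1 - of_int s * y) ^ 2 * \<phi> (Suc k) = y * (\<phi> k + \<phi> (Suc (Suc k)) - 2 * of_int s * \<phi> (Suc k))" for k
    by (subst \<phi>S) (simp only: mult.assoc[symmetric] yb)
  have geo: "\<phi> (Suc k) = y * \<phi> k" for k
  proof -
    define M where "M = 2 / (1 - 4 * norm b)"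
    have M: "norm (\<phi> (Suc i) - y * \<phi> i) \<le> M" for i
    proof -
      have "norm (\<phi> (Suc i) - y * \<phi> i) \<le> norm (\<phi> (Suc i)) + norm y * norm (\<phi> i)"
        using norm_triangle_ineq4[of "\<phi> (Suc i)" "y * \<phi> i"] by (simp add: norm_mult)
      also have "\<dots> \<le> 1 / (1 - 4 * norm b) + 1 * (1 / (1 - 4 * norm b))"
        unfolding \<phi>_def by (intro add_mono mult_mono summable_laurent_coeff(2) s b4) (use y in auto)
      finally show ?thesis by (simp add: M_def)
    qed
    have le: "norm (\<phi> (Suc k) - y * \<phi> k) \<le> norm y ^ n * M" for n
      unfolding recurrence_shift[OF s h0 hS, of k n] norm_mult norm_power
      by (intro mult_left_mono M) auto
    have "(\<lambda>n. norm y ^ n * M) \<longlonglongrightarrow> 0 * M" using y by (intro tendsto_intros LIMSEQ_realpow_zero) auto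
    then have "norm (\<phi> (Suc k) - y * \<phi> k) \<le> 0"
      by (intro LIMSEQ_le_const[of _ 0]) (use le in auto)
    then show ?thesis by simp
  qed
  show ?thesis
    using recurrence_solution[OF s h0 hS geo, of k] nz(2) by (simp add: \<phi>_def field_simps)
qed

text \<open>Solves b = y / (1 - s y)^2 for y in the unit disc. As 1 + 4 s b has positive real part,
  so has its root u, and (u - 1) / (u + 1) maps the right half plane into the disc. With this y the
  quotient (1 - s y)^2 / (1 - y^2) is 1 / u, which makes the dependence on b explicit.\<close>

lemma koebe_csqrt:
  fixes b :: complex
  assumes s: "s = 1 \<or> s = -1" and b: "norm b < 1 / 4"
  defines "u \<equiv> csqrt (1 + 4 * of_int s * b)"
  shows "(\<Sum>j. laurent_coeff s k j * b ^ j) = (of_int s * ((u - 1) / (u + 1))) ^ k / u"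
    and "norm (of_int s * ((u - 1) / (u + 1))) < 1"
proof -
  define z where "z = 1 + 4 * of_int s * b"
  define y where "y = of_int s * ((u - 1) / (u + 1))"
  have ss: "of_int s * (of_int s :: complex) = 1" using s by auto
  have u2: "u ^ 2 = z" by (simp add: u_def z_def)
  have "norm (4 * of_int s * b) < 1" using s b by (auto simp: norm_mult)
  then have Rez: "Re z > 0"
    using abs_Re_le_cmod[of "4 * of_int s * b"] unfolding z_def plus_complex.sel one_complex.sel by linarith
  have Reu: "Re u > 0"
  proof -
    have "Re u \<ge> 0" using csqrt_principal[of z] by (auto simp: u_def z_def)
    moreover have "Re u \<noteq> 0" 
    proof
      assume "Re u = 0"
      then have "Re (u ^ 2) \<le> 0" by (simp add: power2_eq_square)
      then show False using Rez u2 by simp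
    qed
    ultimately show ?thesis by simp
  qed
  have nz: "u \<noteq> 0" "u + 1 \<noteq> 0" using Reu by (auto simp: complex_eq_iff)
  have "norm (u - 1) < norm (u + 1)"
    unfolding cmod_def using Reu by (intro real_sqrt_less_mono) (simp add: power2_eq_square algebra_simps)
  then have ny: "norm y < 1" using nz s by (auto simp: y_def norm_mult norm_divide)
  then show "norm (of_int s * ((u - 1) / (u + 1))) < 1" by (simp add: y_def)
  have sy: "1 - of_int s * y = 2 / (u + 1)"
  proof -
    have "of_int s * y = (u - 1) / (u + 1)" unfolding y_def mult.assoc[symmetric] ss by simp
    then show ?thesis using nz by (simp add: field_simps)
  qed
  have y2: "1 - y ^ 2 = 4 * u / (u + 1) ^ 2"
  proof -
    have "y ^ 2 = ((u - 1) / (u + 1)) ^ 2" using s by (auto simp: y_def power2_eq_square)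
    then show ?thesis using nz by (simp add: power_divide divide_simps) (simp add: power2_eq_square algebra_simps)
  qed
  have "4 * of_int s * b = u ^ 2 - 1" by (simp add: u2 z_def)
  then have "4 * (of_int s * of_int s) * b = of_int s * (u ^ 2 - 1)" by (simp add: mult_ac)
  then have b': "b = of_int s * (u ^ 2 - 1) / 4" by (simp add: ss mult.commute)
  have yb: "b = y / (1 - of_int s * y) ^ 2"
  proof -
    have "X / w / (2 / w) ^ 2 = X * w / 4" if "w \<noteq> 0" for X w :: complex
      using that by (simp add: power2_eq_square)
    from this[OF nz(2), of "of_int s * (u - 1)"]
    have "y / (2 / (u + 1)) ^ 2 = of_int s * (u - 1) * (u + 1) / 4" by (simp add: y_def)
    also have "\<dots> = of_int s * (u ^ 2 - 1) / 4" by (simp add: power2_eq_square algebra_simps)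
    finally show ?thesis unfolding sy b' by (rule sym)
  qed
  have "(\<Sum>j. laurent_coeff s k j * b ^ j) = y ^ k * ((2 / (u + 1)) ^ 2 / (4 * u / (u + 1) ^ 2))"
    using suminf_laurent_coeff[OF s ny yb b, of k] by (simp add: sy y2)
  also have "(2 / (u + 1)) ^ 2 / (4 * u / (u + 1) ^ 2) = 1 / u"
    using nz by (simp add: field_simps)
  finally show "(\<Sum>j. laurent_coeff s k j * b ^ j) = (of_int s * ((u - 1) / (u + 1))) ^ k / u"
    by (simp add: y_def)
qed

text \<open>For r < 1 the point r a belongs to another point of the disc than y; it tends to y
  because the root tends to v = (1 + s y) / (1 - s y), even if |a| = 1/4. The bound is uniform in r
  and depends on y only through 1 - |y|, so one constant serves all nodes of modulus at most \<rho>
  < 1.\<close>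

lemma
  fixes y :: complex
  assumes s: "s = 1 \<or> s = -1" and y: "norm y < 1"
  defines "a \<equiv> y / (1 - of_int s * y) ^ 2"
  assumes a4: "norm a \<le> 1 / 4"
  shows laurent_coeff_limit: "((\<lambda>r. \<Sum>j. laurent_coeff s k j * (of_real r * a) ^ j) \<longlongrightarrow>
            y ^ k * (1 - of_int s * y) ^ 2 / (1 - y ^ 2)) (at_left (1::real))" (is ?lim)
    and laurent_coeff_bound: "\<And>r. 0 < r \<Longrightarrow> r < 1 \<Longrightarrow>
       norm (\<Sum>j. laurent_coeff s k j * (of_real r * a) ^ j) \<le> 4 / (1 - norm y)"
proof -
  define v where "v = (1 + of_int s * y) / (1 - of_int s * y)"
  define z where "z = 1 + 4 * of_int s * a"
  have ss: "of_int s * (of_int s :: complex) = 1" using s by auto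
  have nsy: "norm (of_int s * y) < 1" using s y by (auto simp: norm_mult)
  have nz: "1 - of_int s * y \<noteq> 0" "1 + of_int s * y \<noteq> 0"
    using nsy by (auto simp: add_eq_0_iff)
  have zv: "z = v ^ 2"
  proof -
    define w where "w = of_int s * y"
    have "1 - w \<noteq> 0" using nz by (simp add: w_def)
    then have "1 + 4 * (w / (1 - w) ^ 2) = ((1 + w) / (1 - w)) ^ 2"
      by (simp add: power_divide divide_simps) (simp add: power2_eq_square algebra_simps)
    then show ?thesis unfolding z_def v_def a_def w_def by (simp add: mult.assoc)
  qed
  have Rev: "Re v > 0"
  proof -
    define w where "w = of_int s * y"
    have "Re v = (1 - norm w ^ 2) / norm (1 - w) ^ 2"
      unfolding v_def w_def[symmetric] Re_divide cmod_power2 by (simp add: power2_eq_square algebra_simps)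
    moreover have "norm w ^ 2 < 1" using nsy by (simp add: w_def power_less_one_iff)
    ultimately show ?thesis using nz by (simp add: w_def)
  qed
  \<comment> \<open>Of the two roots of z, v is the principal one, because its real part is
    positive.\<close>
  have csq: "csqrt z = v" using csqrt_square[of v] Rev zv by simp
  have v0: "v \<noteq> 0" "v + 1 \<noteq> 0" using Rev by (auto simp: complex_eq_iff)
  have vy: "of_int s * ((v - 1) / (v + 1)) = y"
  proof -
    define w where "w = of_int s * y"
    have "1 - w \<noteq> 0" using nz by (simp add: w_def)
    then have "v - 1 = 2 * w / (1 - w)" "v + 1 = 2 / (1 - w)"
      unfolding v_def w_def[symmetric] by (simp_all add: divide_simps)
    then have "(v - 1) / (v + 1) = w" using \<open>1 - w \<noteq> 0\<close> by simp
    then show ?thesis unfolding w_def by (simp add: mult.assoc[symmetric] ss)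
  qed
  have val: "y ^ k * (1 - of_int s * y) ^ 2 / (1 - y ^ 2) = (of_int s * ((v - 1) / (v + 1))) ^ k / v"
  proof -
    have "1 - y ^ 2 = (1 - of_int s * y) * (1 + of_int s * y)"
      using ss s by (auto simp: algebra_simps power2_eq_square)
    then have "(1 - of_int s * y) ^ 2 / (1 - y ^ 2) = 1 / v"
      using nz by (simp add: v_def power2_eq_square)
    then show ?thesis unfolding vy by (metis times_divide_eq_right mult_1_right)
  qed
  have small: "norm (of_real r * a) < 1 / 4" if "0 < r" "r < 1" for r :: real
  proof -
    have "norm (of_real r * a) \<le> r * (1 / 4)" using that a4 by (simp add: norm_mult mult_left_mono)
    then show ?thesis using that by simp
  qed
  define u where "u = (\<lambda>r::real. csqrt (1 + 4 * of_int s * (of_real r * a)))"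
  \<comment> \<open>\<open>csqrt\<close> is continuous off the nonpositive real axis; a square of a
    number with positive real part avoids that axis.\<close>
  have zn: "z \<notin> \<real>\<^sub>\<le>\<^sub>0"
  proof
    assume "z \<in> \<real>\<^sub>\<le>\<^sub>0"
    then have "Im (v ^ 2) = 0" "Re (v ^ 2) \<le> 0" by (auto simp: complex_nonpos_Reals_iff zv)
    then show False using Rev mult_pos_pos[OF Rev Rev] by (auto simp: power2_eq_square)
  qed
  have "((\<lambda>r::real. 1 + 4 * of_int s * (of_real r * a)) \<longlongrightarrow> 1 + 4 * of_int s * (of_real 1 * a)) (at_left 1)"
    by (intro tendsto_intros)
  then have ulim: "(u \<longlongrightarrow> v) (at_left 1)"
    unfolding u_def csq[symmetric]
    using isCont_tendsto_compose[OF continuous_at_csqrt[OF zn]] by (simp add: z_def)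
  then have "((\<lambda>r. (of_int s * ((u r - 1) / (u r + 1))) ^ k / u r) \<longlongrightarrow>
      (of_int s * ((v - 1) / (v + 1))) ^ k / v) (at_left 1)"
    using v0 by (intro tendsto_intros) auto
  moreover have "\<forall>\<^sub>F r in at_left (1::real). r \<in> {0<..<1}"
    by (rule eventually_at_left_real) simp
  then have "\<forall>\<^sub>F r in at_left 1. (of_int s * ((u r - 1) / (u r + 1))) ^ k / u r
      = (\<Sum>j. laurent_coeff s k j * (of_real r * a) ^ j)"
    by eventually_elim (simp add: koebe_csqrt(1)[OF s small] u_def)
  ultimately show ?lim unfolding val by (rule Lim_transform_eventually)
  fix r :: real assume r: "0 < r" "r < 1"
  let ?Y = "of_int s * ((u r - 1) / (u r + 1))"
  have "norm ?Y < 1"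
    unfolding u_def by (rule koebe_csqrt(2)[OF s small[OF r]])
  then have "norm ?Y ^ k \<le> 1" by (simp add: power_le_one)
  moreover have "(\<Sum>j. laurent_coeff s k j * (of_real r * a) ^ j) = ?Y ^ k / u r"
    unfolding u_def by (rule koebe_csqrt(1)[OF s small[OF r]])
  ultimately have 1: "norm (\<Sum>j. laurent_coeff s k j * (of_real r * a) ^ j) \<le> 1 / norm (u r)"
    by (simp only: norm_divide norm_power) (intro divide_right_mono, auto)
  \<comment> \<open>\<open>|1 + w| \<le> 2 |1 + r w|\<close> for \<open>|w| \<le> 1\<close>, applied to \<open>w = 4 s a\<close>\<close>
  have 2: "norm z \<le> 2 * norm (u r ^ 2)"
  proof -
    define w where "w = 4 * of_int s * a"
    have w: "norm w \<le> 1" using a4 s by (auto simp: w_def norm_mult)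
    have U: "u r ^ 2 = 1 + of_real r * w" by (simp add: u_def w_def mult_ac)
    have "norm (of_real r * w) \<le> r * 1" using w r by (simp add: norm_mult mult_left_le)
    then have "1 - r \<le> norm (1 + of_real r * w)"
      using norm_triangle_ineq2[of 1 "- (of_real r * w)"] by simp
    then have "norm (1 + of_real r * w) + (1 - r) \<le> 2 * norm (1 + of_real r * w)" by simp
    moreover have "norm (1 + w) \<le> norm (1 + of_real r * w) + norm (of_real (1 - r) * w)"
      using norm_triangle_ineq[of "1 + of_real r * w" "of_real (1 - r) * w"] by (simp add: algebra_simps)
    moreover have "norm (of_real (1 - r) * w) \<le> (1 - r) * 1"
      unfolding norm_mult norm_of_real using w r by (intro mult_mono) auto
    ultimately have "norm (1 + w) \<le> 2 * norm (1 + of_real r * w)"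
      by (metis add_left_mono mult_1_right order_trans)
    then show ?thesis unfolding U z_def w_def[symmetric] .
  qed
  have "norm v ^ 2 \<le> 2 * norm (u r) ^ 2" using 2 by (simp add: zv norm_power)
  also have "\<dots> \<le> (2 * norm (u r)) ^ 2" by (simp add: power_mult_distrib)
  finally have 3: "norm v \<le> 2 * norm (u r)" by (rule power2_le_imp_le) simp
  have "norm v = norm (1 + of_int s * y) / norm (1 - of_int s * y)" by (simp add: v_def norm_divide)
  also have "\<dots> \<ge> (1 - norm y) / 2"
  proof (rule frac_le)
    have sy: "norm (of_int s * y) = norm y" using s by (auto simp: norm_mult)
    show "1 - norm y \<le> norm (1 + of_int s * y)"
      using norm_triangle_ineq2[of 1 "- (of_int s * y)"] sy by simp
    show "norm (1 - of_int s * y) \<le> 2"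
      using norm_triangle_ineq4[of 1 "of_int s * y"] sy y by simp
  qed (use y nz in auto)
  finally have "(1 - norm y) / 4 \<le> norm (u r)" using 3 by simp
  then have "1 / norm (u r) \<le> 1 / ((1 - norm y) / 4)"
    using y by (intro divide_left_mono mult_pos_pos) (auto intro: less_le_trans)
  with 1 show "norm (\<Sum>j. laurent_coeff s k j * (of_real r * a) ^ j) \<le> 4 / (1 - norm y)"
    by (simp add: field_simps)
qed

section \<open>Summation against the binomial coefficients\<close>

text \<open>
  The coefficient bound makes \<open>\<Sum> V\<^bsub>k+i\<^esub> x\<^sup>i\<close> continuous on \<open>|x| < 4\<close>, whereas
  \<open>\<Sum> C\<^sub>m a\<^sub>m\<^sup>k / (1 - a\<^sub>m x)\<close> has a pole at \<open>1 / a\<^sub>m\<close> for the largest \<open>|a\<^sub>m|\<close>: multiply by \<open>1 - r\<close> and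
  let \<open>r \<rightarrow> 1\<close> along \<open>x = r / a\<^sub>m\<close>.
\<close>

lemma weights_le_quarter:
  fixes a C V :: "nat \<Rightarrow> complex"
  assumes C: "summable (\<lambda>m. norm (C m))" and C0: "\<And>m. C m \<noteq> 0"
    and inj: "inj a" and a0: "\<And>m. a m \<noteq> 0" and alim: "a \<longlonglongrightarrow> 0"
    and V: "\<And>j. V j = (\<Sum>m. C m * a m ^ j)" and s: "s = 1 \<or> s = -1"
    and sm: "summable (\<lambda>i. laurent_coeff s k (k + i) * V (k + i))"
  shows "norm (a m) \<le> 1 / 4"
proof (rule ccontr)
  assume neg: "\<not> norm (a m) \<le> 1 / 4"
  \<comment> \<open>The weights tend to 0, so only finitely many have modulus at least that of
    \<open>a m\<close>; hence one of largest modulus exists.\<close>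
  define A where "A = {n. norm (a n) \<ge> norm (a m)}"
  have "\<forall>\<^sub>F n in sequentially. norm (a n) < norm (a m)"
    using tendsto_norm_zero[OF alim] a0[of m] by (intro order_tendstoD(2)) auto
  then obtain N where "\<And>n. n \<ge> N \<Longrightarrow> norm (a n) < norm (a m)"
    by (auto simp: eventually_sequentially)
  then have "A \<subseteq> {..<N}" by (auto simp: A_def) (meson not_le)
  then have "finite A" by (rule finite_subset) simp
  moreover have "m \<in> A" by (simp add: A_def)
  ultimately have "Max ((\<lambda>n. norm (a n)) ` A) \<in> (\<lambda>n. norm (a n)) ` A" by (intro Max_in) auto
  then obtain m0 where "m0 \<in> A" and M: "Max ((\<lambda>n. norm (a n)) ` A) = norm (a m0)" by auto
  then have m0: "m0 \<in> A" "\<And>n. n \<in> A \<Longrightarrow> norm (a n) \<le> norm (a m0)"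
    unfolding M[symmetric] using \<open>finite A\<close> by auto
  define \<rho> where "\<rho> = norm (a m0)"
  have \<rho>: "norm (a n) \<le> \<rho>" for n
    using m0(2)[of n] m0(2)[OF \<open>m \<in> A\<close>] unfolding A_def \<rho>_def
    by (cases "norm (a m) \<le> norm (a n)") auto
  have \<rho>4: "\<rho> > 1 / 4" using neg \<rho>[of m] by simp
  define b where "b = 1 / a m0"
  have nb: "norm b = 1 / \<rho>" by (simp add: b_def \<rho>_def norm_divide)
  have b4: "norm b < 4" using \<rho>4 by (simp add: nb field_simps)
  have ab1: "norm (a n * b) \<le> 1" for n
    using \<rho>[of n] \<rho>4 by (simp add: norm_mult nb field_simps)
  define G where "G = (\<lambda>x. \<Sum>i. V (k + i) * x ^ i)"
  obtain R where R: "norm b < R" "R < 4" using b4 dense by blast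
  have R0: "R > 0" using R norm_ge_zero[of b] by linarith
  have "summable (\<lambda>i. V (k + i) * of_real R ^ i)"
  proof -
    have "convergent (\<lambda>i. laurent_coeff s k (k + i) * V (k + i))"
      using summable_LIMSEQ_zero[OF sm] by (auto simp: convergent_def)
    then obtain T where T: "\<And>i. norm (laurent_coeff s k (k + i) * V (k + i)) \<le> T" "T > 0"
      using Bseq_def[of "\<lambda>i. laurent_coeff s k (k + i) * V (k + i)"] convergent_imp_Bseq by metis
    \<comment> \<open>The terms of a convergent series are bounded, by T; dividing by the binomial
      leaves |V_(k+i)| of order (i + 1) / 4^i, so the power series converges at every R < 4, beyond
      |b|.\<close>
    have bd: "norm (V (k + i) * of_real R ^ i) \<le> T * real (k + 1) * (real (Suc i) * (R / 4) ^ i)" for i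
    proof -
      define B where "B = real ((2 * (k + i)) choose i)"
      have "real (4 ^ i) \<le> real ((k + i + 1) * ((2 * (k + i)) choose i))"
        using four_power_le_binomial[of i k] by (simp only: of_nat_le_iff)
      then have "4 ^ i \<le> real (k + i + 1) * B" by (simp only: B_def of_nat_mult of_nat_power of_nat_numeral)
      then have "4 ^ i * norm (V (k + i)) \<le> real (k + i + 1) * B * norm (V (k + i))"
        by (rule mult_right_mono) simp
      also have "\<dots> = real (k + i + 1) * norm (laurent_coeff s k (k + i) * V (k + i))"
        using s by (auto simp: laurent_coeff_def B_def norm_mult norm_power)
      also have "\<dots> \<le> real ((k + 1) * Suc i) * T"
      proof (rule mult_mono)
        have "k + i + 1 \<le> (k + 1) * Suc i" by simp
        then show "real (k + i + 1) \<le> real ((k + 1) * Suc i)" by (simp only: of_nat_le_iff)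
      qed (use T in auto)
      finally have "4 ^ i * norm (V (k + i)) \<le> real ((k + 1) * Suc i) * T" .
      then have "norm (V (k + i)) \<le> real ((k + 1) * Suc i) * T / 4 ^ i"
        by (simp add: field_simps)
      then have "norm (V (k + i)) * R ^ i \<le> real ((k + 1) * Suc i) * T / 4 ^ i * R ^ i"
        using R0 by (intro mult_right_mono) auto
      also have "\<dots> = T * real (k + 1) * (real (Suc i) * (R / 4) ^ i)"
        unfolding of_nat_mult power_divide by simp
      finally show ?thesis using R0 by (simp add: norm_mult norm_power)
    qed
    have "summable (\<lambda>i. real (Suc i) * (R / 4) ^ i)"
      using geometric_deriv_sums[of "R / 4"] R R0 by (auto simp: sums_iff)
    then have "summable (\<lambda>i. T * real (k + 1) * (real (Suc i) * (R / 4) ^ i))" by (rule summable_mult)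
    then show ?thesis by (rule summable_comparison_test') (rule bd)
  qed
  then have cont: "isCont G b" unfolding G_def
    by (rule isCont_powser) (use R R0 in simp)
  have "((\<lambda>r::real. of_real r * b) \<longlongrightarrow> of_real 1 * b) (at_left 1)" by (intro tendsto_intros)
  then have "((\<lambda>r::real. G (of_real r * b)) \<longlongrightarrow> G b) (at_left 1)"
    using isCont_tendsto_compose[OF cont] by simp
  then have lim1: "((\<lambda>r::real. of_real (1 - r) * G (of_real r * b)) \<longlongrightarrow> of_real (1 - 1) * G b) (at_left 1)"
    by (intro tendsto_mult tendsto_of_real tendsto_diff tendsto_const tendsto_ident_at)
  \<comment> \<open>The last factor is identically 1 for m = m0 and tends to 0 otherwise: other
    weights of the same modulus do no harm, since injectivity gives a_m b \<noteq> 1. Its norm is at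
    most 1, as |1 - r a_m b| \<ge> 1 - r.\<close>
  define f where "f = (\<lambda>m (r::real). C m * a m ^ k * (of_real (1 - r) / (1 - of_real r * (a m * b))))"
  have ne: "norm (1 - of_real r * (a m * b)) \<ge> 1 - r" "1 - of_real r * (a m * b) \<noteq> 0"
    if "0 < r" "r < 1" for r :: real and m
  proof -
    have "norm (of_real r * (a m * b)) \<le> r * 1"
      unfolding norm_mult[of "of_real r"] using ab1[of m] that by (intro mult_mono) auto
    then show "norm (1 - of_real r * (a m * b)) \<ge> 1 - r"
      using norm_triangle_ineq2[of 1 "of_real r * (a m * b)"] by simp
    then show "1 - of_real r * (a m * b) \<noteq> 0" using that by auto
  qed
  have ev: "\<forall>\<^sub>F r in at_left (1::real). r \<in> {0<..<1}"
    by (rule eventually_at_left_real) simp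
  have Gf: "of_real (1 - r) * G (of_real r * b) = (\<Sum>m. f m r)" if r: "0 < r" "r < 1" for r :: real
  proof -
    have bd: "norm (C m * a m ^ (k + i) * (of_real r * b) ^ i) \<le> norm (C m) * \<rho> ^ k * r ^ i" for m i
    proof -
      have "C m * a m ^ (k + i) * (of_real r * b) ^ i = C m * a m ^ k * (of_real r ^ i * (a m * b) ^ i)"
        by (simp add: power_add power_mult_distrib)
      moreover have "norm \<dots> \<le> norm (C m) * \<rho> ^ k * (r ^ i * 1 ^ i)"
        unfolding norm_mult[of "_ ^ i"] norm_mult[of "_ * _ ^ k"] norm_mult[of "C m"] norm_power
        using r \<rho> ab1 \<rho>4 by (intro mult_mono power_mono) auto
      ultimately show ?thesis by (simp only: power_one mult_1_right)
    qed
    have "(\<lambda>i. \<Sum>m. C m * a m ^ (k + i) * (of_real r * b) ^ i) sums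
       (\<Sum>m. \<Sum>i. C m * a m ^ (k + i) * (of_real r * b) ^ i)"
      by (rule suminf_swap_sums[where M = "\<lambda>m. norm (C m) * \<rho> ^ k" and g = "\<lambda>i. r ^ i"])
         (use bd C r \<rho>4 in \<open>auto intro!: summable_mult2 summable_geometric\<close>)
    moreover have "(\<Sum>m. C m * a m ^ (k + i) * (of_real r * b) ^ i) = V (k + i) * (of_real r * b) ^ i" for i
    proof -
      have "summable (\<lambda>m. norm (C m * a m ^ (k + i)))"
      proof (rule summable_comparison_test')
        show "summable (\<lambda>m. norm (C m) * \<rho> ^ (k + i))" using C by (rule summable_mult2)
        show "norm (norm (C m * a m ^ (k + i))) \<le> norm (C m) * \<rho> ^ (k + i)" for m
          using \<rho> by (auto simp: norm_mult norm_power intro!: mult_left_mono power_mono)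
      qed
      then have "summable (\<lambda>m. C m * a m ^ (k + i))" by (rule summable_norm_cancel)
      then show ?thesis unfolding V by (rule suminf_mult2[symmetric])
    qed
    moreover have "(\<Sum>i. C m * a m ^ (k + i) * (of_real r * b) ^ i)
        = C m * a m ^ k / (1 - of_real r * (a m * b))" for m
    proof -
      have "norm (of_real r * (a m * b)) \<le> r * 1"
        unfolding norm_mult[of "of_real r"] using ab1[of m] r by (intro mult_mono) auto
      then have "norm (of_real r * (a m * b)) < 1" using r by simp
      then have "(\<lambda>i. C m * a m ^ k * (of_real r * (a m * b)) ^ i) sums
         (C m * a m ^ k * (1 / (1 - of_real r * (a m * b))))"
        by (intro sums_mult geometric_sums)
      then show ?thesis by (simp add: sums_iff power_add power_mult_distrib mult_ac)
    qed
    ultimately have "(\<lambda>i. V (k + i) * (of_real r * b) ^ i) sums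
        (\<Sum>m. C m * a m ^ k / (1 - of_real r * (a m * b)))" by simp
    then have "G (of_real r * b) = (\<Sum>m. C m * a m ^ k / (1 - of_real r * (a m * b)))"
      by (simp add: G_def sums_iff)
    moreover have "summable (\<lambda>m. C m * a m ^ k / (1 - of_real r * (a m * b)))"
    proof (rule summable_comparison_test')
      show "summable (\<lambda>m. norm (C m) * \<rho> ^ k / (1 - r))" using C by (intro summable_divide summable_mult2)
      show "norm (C m * a m ^ k / (1 - of_real r * (a m * b))) \<le> norm (C m) * \<rho> ^ k / (1 - r)" for m
        unfolding norm_divide norm_mult[of "C m"] norm_power
        using ne(1)[OF r, of m] \<rho>[of m] r \<rho>4
        by (intro frac_le mult_mono power_mono) auto
    qed
    ultimately show ?thesis by (simp add: f_def suminf_mult[symmetric] mult_ac)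
  qed
  have flim: "(f n \<longlongrightarrow> (if n = m0 then C m0 * a m0 ^ k else 0)) (at_left 1)" for n
  proof (cases "n = m0")
    case True
    have "\<forall>\<^sub>F r in at_left (1::real). C m0 * a m0 ^ k = f n r"
      using ev
    proof eventually_elim
      case (elim r)
      then have "1 - complex_of_real r \<noteq> 0" by auto
      then show ?case using True a0[of m0] by (simp add: f_def b_def)
    qed
    from Lim_transform_eventually[OF tendsto_const this] show ?thesis using True by simp
  next
    case False
    then have "a n * b \<noteq> 1" using inj a0[of m0] by (auto simp: b_def field_simps dest: injD)
    then have "((\<lambda>r. C n * a n ^ k * (of_real (1 - r) / (1 - of_real r * (a n * b)))) \<longlongrightarrow>
       C n * a n ^ k * (of_real (1 - 1) / (1 - of_real 1 * (a n * b)))) (at_left (1::real))"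
      by (intro tendsto_intros) auto
    then show ?thesis using False by (simp add: f_def)
  qed
  have fbound: "\<forall>\<^sub>F r in at_left (1::real). \<forall>n. norm (f n r) \<le> norm (C n) * \<rho> ^ k"
    using ev
  proof eventually_elim
    case (elim r)
    then have r: "0 < r" "r < 1" by auto
    show ?case
    proof
      fix n
      have "norm (of_real (1 - r) / (1 - of_real r * (a n * b))) \<le> 1"
        unfolding norm_divide norm_of_real using ne[OF r, of n] r by (simp add: divide_simps)
      then show "norm (f n r) \<le> norm (C n) * \<rho> ^ k"
        unfolding f_def norm_mult[of "_ * _ ^ k"] norm_mult[of "C n"] norm_power
        using \<rho>[of n] \<rho>4 by (intro mult_left_le[THEN order_trans] mult_left_mono power_mono) auto
    qed
  qed
  have "((\<lambda>r. \<Sum>n. f n r) \<longlongrightarrow> (\<Sum>n. if n = m0 then C m0 * a m0 ^ k else 0)) (at_left 1)"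
    by (rule tannery_dominated(2)[OF flim fbound summable_mult2[OF C]]) simp
  moreover have "(\<Sum>n. if n = m0 then C m0 * a m0 ^ k else 0) = C m0 * a m0 ^ k"
    by (subst suminf_finite[of "{m0}"]) auto
  moreover have "\<forall>\<^sub>F r in at_left 1. of_real (1 - r) * G (of_real r * b) = (\<Sum>n. f n r)"
    using ev by eventually_elim (use Gf in auto)
  from Lim_transform_eventually[OF lim1 this]
  have "((\<lambda>r. \<Sum>n. f n r) \<longlongrightarrow> 0) (at_left 1)" by simp
  ultimately have "C m0 * a m0 ^ k = 0"
    using tendsto_unique[of "at_left (1::real)"] by fastforce
  then show False using C0 a0 by simp
qed

text \<open>With |a_m| \<le> 1/4 the products of coefficient and power are bounded by 1, so
  inserting r^i makes the double series absolutely convergent and the order of summation can be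
  exchanged. As r tends to 1, Abel's theorem treats the left side and dominated convergence the
  right side; \<rho> < 1 makes the majorant uniform in m.\<close>

lemma laurent_series_value:
  fixes a C V y :: "nat \<Rightarrow> complex"
  assumes C: "summable (\<lambda>m. norm (C m))" and C0: "\<And>m. C m \<noteq> 0"
    and inj: "inj a" and a0: "\<And>m. a m \<noteq> 0" and alim: "a \<longlonglongrightarrow> 0"
    and V: "\<And>j. V j = (\<Sum>m. C m * a m ^ j)" and s: "s = 1 \<or> s = -1"
    and sm: "summable (\<lambda>i. laurent_coeff s k (k + i) * V (k + i))"
    and y: "\<And>m. norm (y m) \<le> \<rho>" "\<rho> < 1" and ay: "\<And>m. a m = y m / (1 - of_int s * y m) ^ 2"
  shows "(\<Sum>i. laurent_coeff s k (k + i) * V (k + i)) =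
     (\<Sum>m. C m * (y m ^ k * (1 - of_int s * y m) ^ 2 / (1 - y m ^ 2)))"
proof -
  have a4: "norm (a m) \<le> 1 / 4" for m
    by (rule weights_le_quarter[OF C C0 inj a0 alim V s sm])
  have y1: "norm (y m) < 1" for m using y(1)[of m] y(2) by simp
  define \<Phi> where "\<Phi> = (\<lambda>m (r::real). \<Sum>j. laurent_coeff s k j * (of_real r * a m) ^ j)"
  have ev: "\<forall>\<^sub>F r in at_left (1::real). r \<in> {0<..<1}"
    by (rule eventually_at_left_real) simp
  let ?t = "\<lambda>i. laurent_coeff s k (k + i) * V (k + i)"
  \<comment> \<open>The factor r^k completes r^i to r^(k+i), so the inner sum becomes the generating
    function at r a_m; its terms with j < k are zero.\<close>
  have eq: "of_real r ^ k * (\<Sum>i. ?t i * of_real r ^ i) = (\<Sum>m. C m * \<Phi> m r)"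
    if r: "0 < r" "r < 1" for r :: real
  proof -
    define f where "f = (\<lambda>m i. C m * (laurent_coeff s k (k + i) * a m ^ (k + i) * of_real r ^ i))"
    have la: "norm (laurent_coeff s k j * a m ^ j) \<le> 1" for m j
    proof -
      have "norm (laurent_coeff s k j * a m ^ j) \<le> 4 ^ j * (1 / 4) ^ j"
        unfolding norm_mult norm_power by (intro mult_mono norm_laurent_coeff_le s power_mono a4) auto
      then show ?thesis by (simp add: power_divide)
    qed
    have bd: "norm (f m i) \<le> norm (C m) * r ^ i" for m i
    proof -
      have "norm (f m i) \<le> norm (C m) * (1 * r ^ i)"
        unfolding f_def norm_mult[of "C m"] norm_mult[of "_ * _"] norm_power[of "of_real r"]
        using r by (intro mult_mono la) auto
      then show ?thesis by simp
    qed
    have "(\<lambda>i. \<Sum>m. f m i) sums (\<Sum>m. \<Sum>i. f m i)"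
      by (rule suminf_swap_sums[where M = "\<lambda>m. norm (C m)" and g = "\<lambda>i. r ^ i"])
         (use bd C r in \<open>auto intro!: summable_geometric\<close>)
    moreover have "(\<Sum>m. f m i) = ?t i * of_real r ^ i" for i
    proof -
      have "summable (\<lambda>m. norm (C m * a m ^ (k + i)))"
      proof (rule summable_comparison_test')
        show "summable (\<lambda>m. norm (C m) * (1 / 4) ^ (k + i))" using C by (rule summable_mult2)
        show "norm (norm (C m * a m ^ (k + i))) \<le> norm (C m) * (1 / 4) ^ (k + i)" for m
          using power_mono[OF a4[of m] norm_ge_zero, of "k + i"] by (auto simp: norm_mult norm_power intro!: mult_left_mono)
      qed
      then have "summable (\<lambda>m. C m * a m ^ (k + i))" by (rule summable_norm_cancel)
      then have "(\<Sum>m. (laurent_coeff s k (k + i) * of_real r ^ i) * (C m * a m ^ (k + i)))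
          = (laurent_coeff s k (k + i) * of_real r ^ i) * V (k + i)"
        unfolding V by (rule suminf_mult)
      then show ?thesis by (simp add: f_def mult_ac)
    qed
    moreover have "of_real r ^ k * (\<Sum>i. f m i) = C m * \<Phi> m r" "summable (f m)" for m
    proof -
      have sm: "summable (f m)"
      proof (rule summable_comparison_test')
        show "summable (\<lambda>i. norm (C m) * r ^ i)" using r by (intro summable_mult summable_geometric) auto
      qed (rule bd)
      then show "summable (f m)" .
      have "norm (of_real r * a m) \<le> r * (1 / 4)"
        unfolding norm_mult norm_of_real using a4[of m] r by (intro mult_mono) auto
      then have "norm (of_real r * a m) < 1 / 4" using r by simp
      from summable_laurent_coeff(1)[OF s this, of k]
      have "\<Phi> m r = (\<Sum>i. laurent_coeff s k (i + k) * (of_real r * a m) ^ (i + k))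
           + (\<Sum>i<k. laurent_coeff s k i * (of_real r * a m) ^ i)"
        unfolding \<Phi>_def by (rule suminf_split_initial_segment)
      also have "(\<Sum>i<k. laurent_coeff s k i * (of_real r * a m) ^ i) = 0"
        by (intro sum.neutral) (auto simp: laurent_coeff_def)
      finally have \<Phi>: "\<Phi> m r = (\<Sum>i. laurent_coeff s k (i + k) * (of_real r * a m) ^ (i + k))" by simp
      have "summable (\<lambda>i. laurent_coeff s k (i + k) * (of_real r * a m) ^ (i + k))"
        using \<open>summable (\<lambda>j. laurent_coeff s k j * (of_real r * a m) ^ j)\<close>
        by (rule summable_ignore_initial_segment)
      then have "C m * \<Phi> m r = (\<Sum>i. C m * (laurent_coeff s k (i + k) * (of_real r * a m) ^ (i + k)))"
        unfolding \<Phi> by (rule suminf_mult[symmetric])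
      also have "\<dots> = (\<Sum>i. of_real r ^ k * f m i)"
        by (simp add: f_def power_mult_distrib power_add mult_ac add.commute)
      also have "\<dots> = of_real r ^ k * (\<Sum>i. f m i)" using sm by (rule suminf_mult)
      finally show "of_real r ^ k * (\<Sum>i. f m i) = C m * \<Phi> m r" by simp
    qed
    moreover have "summable (\<lambda>m. \<Sum>i. f m i)"
    proof (rule summable_comparison_test')
      show "summable (\<lambda>m. norm (C m) * (\<Sum>i. r ^ i))" using C by (rule summable_mult2)
      fix m
      have g: "summable (\<lambda>i. norm (C m) * r ^ i)" using r by (intro summable_mult summable_geometric) auto
      have "norm (\<Sum>i. f m i) \<le> (\<Sum>i. norm (C m) * r ^ i)"
        by (rule norm_suminf_le[OF bd g])
      also have "\<dots> = norm (C m) * (\<Sum>i. r ^ i)"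
        using r by (intro suminf_mult summable_geometric) auto
      finally show "norm (\<Sum>i. f m i) \<le> norm (C m) * (\<Sum>i. r ^ i)" .
    qed
    then have "of_real r ^ k * (\<Sum>m. \<Sum>i. f m i) = (\<Sum>m. of_real r ^ k * (\<Sum>i. f m i))"
      by (rule suminf_mult[symmetric])
    ultimately show ?thesis by (simp add: sums_iff)
  qed
  have "((\<lambda>r. of_real r ^ k * (\<Sum>i. ?t i * of_real r ^ i)) \<longlongrightarrow> of_real 1 ^ k * suminf ?t) (at_left (1::real))"
    by (intro tendsto_mult abel_limit sm tendsto_intros)
  moreover have "\<forall>\<^sub>F r in at_left 1. of_real r ^ k * (\<Sum>i. ?t i * of_real r ^ i) = (\<Sum>m. C m * \<Phi> m r)"
    using ev by eventually_elim (use eq in auto)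
  ultimately have 1: "((\<lambda>r. \<Sum>m. C m * \<Phi> m r) \<longlongrightarrow> suminf ?t) (at_left 1)"
    using Lim_transform_eventually by fastforce
  have "((\<lambda>r. \<Sum>m. C m * \<Phi> m r) \<longlongrightarrow> (\<Sum>m. C m * (y m ^ k * (1 - of_int s * y m) ^ 2 / (1 - y m ^ 2)))) (at_left 1)"
  proof (rule tannery_dominated(2)[where M = "\<lambda>m. norm (C m) * (4 / (1 - \<rho>))"])
    show "((\<lambda>r. C m * \<Phi> m r) \<longlongrightarrow> C m * (y m ^ k * (1 - of_int s * y m) ^ 2 / (1 - y m ^ 2))) (at_left 1)" for m
      unfolding \<Phi>_def ay using laurent_coeff_limit[OF s y1] a4[of m, unfolded ay]
      by (intro tendsto_mult tendsto_const) auto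
    show "\<forall>\<^sub>F r in at_left 1. \<forall>m. norm (C m * \<Phi> m r) \<le> norm (C m) * (4 / (1 - \<rho>))"
      using ev
    proof eventually_elim
      case (elim r)
      show ?case
      proof
        fix m
        have "norm (\<Phi> m r) \<le> 4 / (1 - norm (y m))"
          unfolding \<Phi>_def ay
          by (rule laurent_coeff_bound[OF s y1 a4[of m, unfolded ay]]) (use elim in auto)
        also have "\<dots> \<le> 4 / (1 - \<rho>)" using y(1)[of m] y(2) by (intro divide_left_mono) auto
        finally show "norm (C m * \<Phi> m r) \<le> norm (C m) * (4 / (1 - \<rho>))"
          unfolding norm_mult by (rule mult_left_mono) simp
      qed
    qed
    show "summable (\<lambda>m. norm (C m) * (4 / (1 - \<rho>)))" using C by (rule summable_mult2)
  qed simp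
  from tendsto_unique[OF _ 1 this] show ?thesis by simp
qed

section \<open>The partial fraction expansion for complex q\<close>

lemma
  fixes a p :: complex
  assumes p: "norm p < 1"
  shows qpoch_tendsto: "qpoch a p \<longlonglongrightarrow> qpoch_inf a p"
    and qpoch_inf_nonzero: "(\<And>r. a * p ^ r \<noteq> 1) \<Longrightarrow> qpoch_inf a p \<noteq> 0"
proof -
  have "summable (\<lambda>r. norm a * norm p ^ r)" using p by (intro summable_mult summable_geometric) auto
  then have "abs_convergent_prod (\<lambda>r. 1 - a * p ^ r)"
    by (intro summable_imp_abs_convergent_prod) (simp add: norm_mult norm_power)
  then have cp: "convergent_prod (\<lambda>r. 1 - a * p ^ r)"
    by (rule abs_convergent_prod_imp_convergent_prod)
  have Suc: "(\<lambda>n. qpoch a p (Suc n)) = (\<lambda>n. \<Prod>r\<le>n. 1 - a * p ^ r)"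
    by (simp add: qpoch_def lessThan_Suc_atMost)
  have "convergent (\<lambda>n. qpoch a p (Suc n))"
    unfolding Suc using cp by (rule convergent_prod_imp_convergent)
  then have "convergent (qpoch a p)" using convergent_Suc_iff by blast
  then show lim: "qpoch a p \<longlonglongrightarrow> qpoch_inf a p"
    by (simp add: qpoch_inf_def convergent_LIMSEQ_iff)
  assume "\<And>r. a * p ^ r \<noteq> 1"
  then obtain L where L: "(\<lambda>n. \<Prod>r\<le>n. 1 - a * p ^ r) \<longlonglongrightarrow> L" "L \<noteq> 0"
    using convergent_prod_iff_nz_lim[of "\<lambda>r. 1 - a * p ^ r"] cp by auto
  have "qpoch_inf a p = L"
    using LIMSEQ_Suc[OF lim] L(1) unfolding Suc by (rule LIMSEQ_unique)
  with L show "qpoch_inf a p \<noteq> 0" by simp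
qed

lemma norm_node_le:
  fixes q :: complex
  assumes "norm q < 1"
  shows "norm (node e q i) \<le> norm q"
  using assms power_decreasing[of 1 "e * i + 1" "norm q"] by (simp add: node_def norm_mult norm_power)

lemma norm_one_minus_sign:
  fixes y :: complex
  assumes "s = 1 \<or> s = -1"
  shows "1 - norm y \<le> norm (1 - of_int s * y)" "norm (1 - of_int s * y) \<le> 1 + norm y"
  using assms norm_triangle_ineq2[of 1 "of_int s * y"] norm_triangle_ineq4[of 1 "of_int s * y"]
  by (auto simp: norm_mult)

lemma norm_weight_le:
  fixes q :: complex
  assumes "norm q < 1" "s = 1 \<or> s = -1"
  shows "norm (weight s e q i) \<le> norm (node e q i) / (1 - norm q) ^ 2"
proof -
  have "(1 - norm q) ^ 2 \<le> norm (1 - of_int s * node e q i) ^ 2"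
    using norm_one_minus_sign(1)[OF assms(2), of "node e q i"] norm_node_le[OF assms(1), of e i] assms(1)
    by (intro power_mono) auto
  then show ?thesis unfolding weight_def norm_divide norm_power
    using assms(1) by (intro divide_left_mono mult_pos_pos) (auto intro: zero_less_power less_le_trans)
qed

lemma summable_norm_node:
  fixes q :: complex
  assumes "norm q < 1" "e \<ge> 1"
  shows "summable (\<lambda>i. norm (node e q i))"
proof -
  have "norm q ^ e < 1" using assms by (simp add: power_less_one_iff)
  then have "summable (\<lambda>i. norm q * (norm q ^ e) ^ i)"
    by (intro summable_mult summable_geometric) auto
  then show ?thesis by (simp add: node_def norm_mult norm_power power_mult)
qed

lemma summable_norm_weight:
  fixes q :: complex
  assumes "norm q < 1" "e \<ge> 1" "s = 1 \<or> s = -1"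
  shows "summable (\<lambda>i. norm (weight s e q i))"
proof (rule summable_comparison_test')
  show "summable (\<lambda>i. norm (node e q i) / (1 - norm q) ^ 2)"
    by (intro summable_divide summable_norm_node assms)
qed (use norm_weight_le[OF assms(1,3)] in auto)

lemma norm_kappa_le:
  fixes q :: complex
  assumes "norm q < 1" "e \<ge> 1"
  shows "norm (kappa e q m) \<le> 2 * norm q ^ m"
proof -
  have "m \<le> m * (m + 1) div 2"
  proof (cases m)
    case (Suc n)
    then have "2 * m \<le> m * (m + 1)" by simp
    then show ?thesis by linarith
  qed simp
  then have "1 * m \<le> e * (m * (m + 1) div 2)" using assms by (intro mult_mono) auto
  then have 1: "norm q ^ (e * (m * (m + 1) div 2)) \<le> norm q ^ m"
    using assms by (intro power_decreasing) auto
  have 2: "norm (if e = 1 then 1 - q ^ (m + 1) else 1) \<le> 2"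
    using norm_triangle_ineq4[of 1 "q ^ (m + 1)"] power_le_one[of "norm q" "m + 1"] assms
    by (auto simp: norm_mult norm_power)
  show ?thesis unfolding kappa_def norm_mult norm_power
    using mult_mono[OF 1 2] by (simp add: mult.commute)
qed

definition lcoeff_inf :: "int \<Rightarrow> nat \<Rightarrow> 'a::{comm_ring_1,inverse,t2_space} \<Rightarrow> nat \<Rightarrow> 'a" where
  "lcoeff_inf s e q m =
     qpoch_inf (of_int s * q) (q ^ e) ^ 2 / qpoch_inf (q ^ e) (q ^ e) ^ 2 * kappa e q m"

text \<open>The limit of \<open>pf_coeff\<close> for N to infinity, i.e. C_m for the full sequence
  of weights.\<close>

definition residue_coeff :: "int \<Rightarrow> nat \<Rightarrow> complex \<Rightarrow> nat \<Rightarrow> complex" where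
  "residue_coeff s e q m = 
     lcoeff_inf s e q m * ((1 - node e q m ^ 2) / (1 - of_int s * node e q m) ^ 2)"

context
  fixes q :: complex and s :: int and e :: nat
  assumes q0: "q \<noteq> 0" and q1: "norm q < 1"
    and s: "s = 1 \<or> s = -1" and e: "e = 1 \<or> e = 2"
begin

lemma power_neq_1: "n \<ge> 1 \<Longrightarrow> q ^ n \<noteq> 1"
proof
  assume "n \<ge> 1" "q ^ n = 1"
  then have "norm q ^ n = 1" by (simp flip: norm_power)
  moreover have "norm q ^ n < 1" using q1 \<open>n \<ge> 1\<close> by (simp add: power_less_one_iff)
  ultimately show False by simp
qed

lemmas field_assms = q0 power_neq_1 s e

lemma norm_power_e: "norm (q ^ e) < 1"
  using q1 e by (auto simp: norm_power power_less_one_iff)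

lemma lcoeff_tendsto: "(\<lambda>N. lcoeff s e N q m) \<longlonglongrightarrow> lcoeff_inf s e q m"
proof -
  have nz: "qpoch_inf (q ^ e) (q ^ e) \<noteq> 0"
    by (rule qpoch_inf_nonzero[OF norm_power_e])
       (use power_e_nonzero[OF field_assms, of "Suc _"] in auto)
  have s1: "filterlim (\<lambda>N. N - 1 - m) sequentially sequentially"
    unfolding filterlim_at_top
  proof
    fix Z show "\<forall>\<^sub>F N in sequentially. Z \<le> N - 1 - m"
      using eventually_ge_at_top[of "Z + 1 + m"] by eventually_elim simp
  qed
  have s2: "filterlim (\<lambda>N. N + m + 2 - e) sequentially sequentially"
    unfolding filterlim_at_top
  proof
    fix Z show "\<forall>\<^sub>F N in sequentially. Z \<le> N + m + 2 - e"
      using eventually_ge_at_top[of Z] by eventually_elim (use e in auto)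
  qed
  show ?thesis unfolding lcoeff_def lcoeff_inf_def
    unfolding times_divide_eq_left power2_eq_square[of "qpoch_inf (q ^ e) (q ^ e)"] using nz
    by (intro tendsto_divide tendsto_mult tendsto_power tendsto_const qpoch_tendsto norm_power_e
        filterlim_compose[OF qpoch_tendsto s1] filterlim_compose[OF qpoch_tendsto s2]) auto
qed

text \<open>The limit of the Pochhammer denominators is nonzero, so their inverses are bounded; the
  decay in m comes from \<open>kappa\<close> alone. Uniformity in N is what dominated convergence
  uses.\<close>

lemma lcoeff_bound: "\<exists>K. \<forall>N m. norm (lcoeff s e N q m) \<le> K * norm q ^ m"
proof -
  have nz: "qpoch_inf (q ^ e) (q ^ e) \<noteq> 0"
    by (rule qpoch_inf_nonzero[OF norm_power_e])
       (use power_e_nonzero[OF field_assms, of "Suc _"] in auto)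
  have "convergent (qpoch (of_int s * q) (q ^ e))"
    using qpoch_tendsto[OF norm_power_e] by (auto simp: convergent_def)
  then obtain B where B: "\<And>n. norm (qpoch (of_int s * q) (q ^ e) n) \<le> B" "B > 0"
    using Bseq_def[of "qpoch (of_int s * q) (q ^ e)"] convergent_imp_Bseq by metis
  have "convergent (\<lambda>n. inverse (qpoch (q ^ e) (q ^ e) n))"
    using tendsto_inverse[OF qpoch_tendsto[OF norm_power_e] nz] by (auto simp: convergent_def)
  then obtain D where D: "\<And>n. norm (inverse (qpoch (q ^ e) (q ^ e) n)) \<le> D" "D > 0"
    using Bseq_def[of "\<lambda>n. inverse (qpoch (q ^ e) (q ^ e) n)"] convergent_imp_Bseq by metis
  have "norm (lcoeff s e N q m) \<le> (B ^ 2 * (D * D) * 2) * norm q ^ m" for N m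
  proof -
    have eq: "lcoeff s e N q m = qpoch (of_int s * q) (q ^ e) N ^ 2 *
       (inverse (qpoch (q ^ e) (q ^ e) (N - 1 - m)) * inverse (qpoch (q ^ e) (q ^ e) (N + m + 2 - e)))
        * kappa e q m"
      by (simp add: lcoeff_def divide_inverse mult_ac)
    have "norm (lcoeff s e N q m) \<le> B ^ 2 * (D * D) * (2 * norm q ^ m)"
      unfolding eq norm_mult norm_power
      by (intro mult_mono power_mono B D norm_kappa_le q1) (use e B(2) D(2) in auto)
    then show ?thesis by simp
  qed
  then show ?thesis by blast
qed

lemma pf_coeff_weight_eq:
  assumes "m < N"
  shows "pf_coeff (weight s e q) N m
    = lcoeff s e N q m * ((1 - node e q m ^ 2) / (1 - of_int s * node e q m) ^ 2)"
proof -
  have "1 - node e q m ^ 2 \<noteq> 0" "1 - of_int s * node e q m \<noteq> 0"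
    using node_mult_nonzero[OF field_assms, of m m] one_minus_node_nonzero[OF field_assms, of m]
    by (auto simp: power2_eq_square)
  then show ?thesis
    using pf_coeff_weight[OF field_assms assms] by (simp add: divide_simps)
qed

lemma norm_quot_le:
  "norm ((1 - node e q m ^ 2) / (1 - of_int s * node e q m) ^ 2) \<le> 2 / (1 - norm q) ^ 2"
proof -
  have "(1 - norm q) ^ 2 \<le> norm (1 - of_int s * node e q m) ^ 2"
    using norm_one_minus_sign(1)[OF s, of "node e q m"] norm_node_le[OF q1, of e m] q1
    by (intro power_mono) auto
  moreover have "norm (1 - node e q m ^ 2) \<le> 2"
    using norm_triangle_ineq4[of 1 "node e q m ^ 2"] norm_node_le[OF q1, of e m] q1
      power_le_one[of "norm (node e q m)" 2] by (auto simp: norm_power)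
  ultimately show ?thesis unfolding norm_divide norm_power
    using q1 by (intro frac_le) auto
qed

text \<open>Two limits of the same finite sums \<open>complete_hom\<close>: along the boxes of
  tuples, and through the partial fractions, extended by 0 for m \<ge> N so that all sums run over
  every m.\<close>

lemma
  shows tuple_sum_eq: "tuple_sum s e j q = (\<Sum>m. residue_coeff s e q m * weight s e q m ^ j)"
    and summable_residue_coeff: "summable (\<lambda>m. norm (residue_coeff s e q m))"
proof -
  define c where "c = (\<lambda>m. (1 - node e q m ^ 2) / (1 - of_int s * node e q m) ^ 2)"
  have rc: "residue_coeff s e q m = lcoeff_inf s e q m * c m" for m
    by (simp add: residue_coeff_def c_def)
  obtain K where K: "\<And>N m. norm (lcoeff s e N q m) \<le> K * norm q ^ m" using lcoeff_bound by blast
  have K0: "K \<ge> 0" using order_trans[OF norm_ge_zero K[of 0 0]] by simp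
  define C where "C = 2 / (1 - norm q) ^ 2"
  have "C > 0" using q1 by (simp add: C_def)
  have *: "summable (\<lambda>m. norm (residue_coeff s e q m * weight s e q m ^ j)) \<and>
     tuple_sum s e j q = (\<Sum>m. residue_coeff s e q m * weight s e q m ^ j)" for j
  proof -
    define f where "f = (\<lambda>m N. if m < N then pf_coeff (weight s e q) N m * weight s e q m ^ j else 0)"
    define W where "W = (1 / (1 - norm q) ^ 2) ^ j"
    have w: "norm (weight s e q m ^ j) \<le> W" for m
      unfolding W_def norm_power
      by (intro power_mono order_trans[OF norm_weight_le[OF q1 s]] divide_right_mono
            order_trans[OF norm_node_le[OF q1]]) (use q1 in auto)
    have lim: "(\<lambda>N. f m N) \<longlonglongrightarrow> residue_coeff s e q m * weight s e q m ^ j" for m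
    proof -
      have "(\<lambda>N. lcoeff s e N q m * c m * weight s e q m ^ j) \<longlonglongrightarrow> lcoeff_inf s e q m * c m * weight s e q m ^ j"
        by (intro tendsto_intros lcoeff_tendsto)
      then show ?thesis unfolding rc
      proof (rule Lim_transform_eventually)
        show "\<forall>\<^sub>F N in sequentially. lcoeff s e N q m * c m * weight s e q m ^ j = f m N"
          using eventually_gt_at_top[of m]
          by eventually_elim (simp add: f_def pf_coeff_weight_eq c_def)
      qed
    qed
    have bound: "norm (f m N) \<le> K * norm q ^ m * C * W" for m N
    proof (cases "m < N")
      case True
      then have "f m N = lcoeff s e N q m * c m * weight s e q m ^ j"
        by (simp add: f_def pf_coeff_weight_eq c_def)
      moreover have "norm \<dots> \<le> K * norm q ^ m * C * W"
        unfolding norm_mult c_def C_def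
        by (intro mult_mono K norm_quot_le w) (use K0 q1 in auto)
      ultimately show ?thesis by simp
    next
      case False
      then show ?thesis using K0 \<open>C > 0\<close> q1 by (simp add: f_def W_def)
    qed
    have sm: "summable (\<lambda>m. K * norm q ^ m * C * W)"
      by (intro summable_mult2 summable_mult summable_geometric) (use q1 in auto)
    have T: "summable (\<lambda>m. norm (residue_coeff s e q m * weight s e q m ^ j)) \<and>
       (\<lambda>N. \<Sum>m. f m N) \<longlonglongrightarrow> (\<Sum>m. residue_coeff s e q m * weight s e q m ^ j)"
      using tannery_dominated[OF lim _ sm] bound by simp
    have "(\<Sum>m. f m N) = complete_hom (weight s e q) N j" if "N \<ge> 1" for N
    proof -
      have "(\<Sum>m. f m N) = (\<Sum>m<N. f m N)"
        by (intro suminf_finite) (auto simp: f_def)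
      then show ?thesis
        using complete_hom_eq_sum_powers[OF inj_weight[OF field_assms] weight_nonzero[OF field_assms] that]
        by (simp add: f_def)
    qed
    then have ev: "\<forall>\<^sub>F N in sequentially. (\<Sum>m. f m N) = complete_hom (weight s e q) N j"
      by (intro eventually_sequentiallyI[of 1])
    have "(\<lambda>N. complete_hom (weight s e q) N j) \<longlonglongrightarrow> (\<Sum>m. residue_coeff s e q m * weight s e q m ^ j)"
      by (rule Lim_transform_eventually[OF conjunct2[OF T] ev])
    moreover have "(\<lambda>N. complete_hom (weight s e q) N j) \<longlonglongrightarrow> tuple_sum s e j q"
      by (intro complete_hom_tendsto_tuple_sum tuples_summable_on summable_norm_weight q1 s)
         (use e in auto)
    ultimately have "tuple_sum s e j q = (\<Sum>m. residue_coeff s e q m * weight s e q m ^ j)"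
      by (rule LIMSEQ_unique[rotated])
    with T show ?thesis by simp
  qed
  show "tuple_sum s e j q = (\<Sum>m. residue_coeff s e q m * weight s e q m ^ j)" using * by blast
  show "summable (\<lambda>m. norm (residue_coeff s e q m))" using *[of 0] by simp
qed

lemma residue_coeff_nonzero: "residue_coeff s e q m \<noteq> 0"
proof -
  have "qpoch_inf (q ^ e) (q ^ e) \<noteq> 0"
    by (rule qpoch_inf_nonzero[OF norm_power_e])
       (use power_e_nonzero[OF field_assms, of "Suc _"] in auto)
  moreover have "qpoch_inf (of_int s * q) (q ^ e) \<noteq> 0"
  proof (rule qpoch_inf_nonzero[OF norm_power_e])
    show "of_int s * q * (q ^ e) ^ r \<noteq> 1" for r
      using one_minus_node_nonzero[OF field_assms, of r] by (auto simp: node_def power_mult mult.assoc)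
  qed
  moreover have "kappa e q m \<noteq> 0"
    using q0 power_neq_1[of "m + 1"] by (auto simp: kappa_def)
  moreover have "1 - node e q m ^ 2 \<noteq> 0" "1 - of_int s * node e q m \<noteq> 0"
    using node_mult_nonzero[OF field_assms, of m m] one_minus_node_nonzero[OF field_assms, of m]
    by (auto simp: power2_eq_square)
  ultimately show ?thesis by (simp add: residue_coeff_def lcoeff_inf_def)
qed

end

section \<open>The identities for complex q\<close>

text \<open>Both right-hand sides in the shape in which the sum over m delivers them: each node
  contributes its k-th power.\<close>

definition series_rhs :: "int \<Rightarrow> nat \<Rightarrow> nat \<Rightarrow> 'a::{comm_ring_1,inverse,t2_space} \<Rightarrow> 'a" where
  "series_rhs s e k q = qpoch_inf (of_int s * q) (q ^ e) ^ 2 / qpoch_inf (q ^ e) (q ^ e) ^ 2 *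
     (\<Sum>m. kappa e q m * node e q m ^ k)"

lemma V_term_eq: "V_term s k q (k + i) = laurent_coeff s k (k + i) * tuple_sum s 1 (k + i) q"
  by (simp add: V_term_def laurent_coeff_def V_eq_tuple_sum)

lemma W_term_eq: "W_term s k q (k + i) = laurent_coeff s k (k + i) * tuple_sum s 2 (k + i) q"
  by (simp add: W_term_def laurent_coeff_def W_eq_tuple_sum)

lemma triangle_diff: "(k + i) * (k + i + 1) div 2 - k * (k + 1) div 2 = k * i + i * (i + 1) div 2" for k i :: nat
proof -
  have *: "(k + i) * (k + i + 1) = k * (k + 1) + 2 * (k * i) + i * (i + 1)" by (simp add: algebra_simps)
  have "even (k * (k + 1))" by simp
  then obtain A where A: "k * (k + 1) = 2 * A" by (rule dvdE)
  have "even (i * (i + 1))" by simp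
  then obtain B where B: "i * (i + 1) = 2 * B" by (rule dvdE)
  have "(k + i) * (k + i + 1) = 2 * (A + k * i + B)" unfolding * A B by simp
  then show ?thesis unfolding A B by simp
qed

text \<open>The factor 1 - q^(m+1) splits the m-th summand into q^k b_m + b_(m+1), two shifted
  copies of one series; the -1 is the missing term b_0. Keeping the remainder b_M makes this a
  finite identity, usable in both topologies.\<close>

lemma sum_kappa_1:
  fixes q :: "'a::comm_ring_1" and k :: nat
  defines "b \<equiv> \<lambda>i. (-1) ^ i * q ^ (k * i + i * (i + 1) div 2)"
  shows "(\<Sum>m<M. kappa 1 q m * node 1 q m ^ k) = - 1 + (1 + q ^ k) * (\<Sum>i<M. b i) + b M"
proof (induction M)
  case 0
  then show ?case by (simp add: b_def)
next
  case (Suc M)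
  have ex: "Suc M * (Suc M + 1) div 2 = M * (M + 1) div 2 + (M + 1)" by (simp add: algebra_simps)
  have "kappa 1 q M * node 1 q M ^ k = q ^ k * b M + b (Suc M)"
    unfolding b_def kappa_def node_def ex
    by (simp add: power_add power_mult[symmetric] algebra_simps)
  then show ?case using Suc by (simp add: algebra_simps)
qed

lemma kappa_2: "kappa 2 q i * node 2 q i ^ k = (-1) ^ i * q ^ ((k + i) * (k + i + 1) - k ^ 2)"
proof -
  have "(k + i) * (k + i + 1) - k ^ 2 = i * (i + 1) + (2 * i + 1) * k"
    by (simp add: algebra_simps power2_eq_square)
  moreover have "2 * (i * (i + 1) div 2) = i * (i + 1)" by simp
  ultimately show ?thesis unfolding kappa_def node_def by (simp only: power_add power_mult) simp
qed

lemma W_rhs_eq: "W_rhs s k q = series_rhs s 2 k q"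
  unfolding W_rhs_def series_rhs_def Let_def kappa_2 by simp

lemma V_rhs_eq_if_sums:
  fixes q :: "'a::{comm_ring_1,inverse,t2_space}"
  assumes "(\<lambda>i. (-1) ^ i * q ^ (k * i + i * (i + 1) div 2)) sums S"
    and "(\<lambda>m. kappa 1 q m * node 1 q m ^ k) sums (- 1 + (1 + q ^ k) * S)"
  shows "V_rhs s k q = series_rhs s 1 k q"
  unfolding V_rhs_def series_rhs_def Let_def triangle_diff
  using assms[THEN sums_unique] by simp

lemma V_rhs_eq:
  fixes q :: complex
  assumes q: "norm q < 1"
  shows "V_rhs s k q = series_rhs s 1 k q"
proof -
  define b where "b = (\<lambda>i. (-1) ^ i * q ^ (k * i + i * (i + 1) div 2))"
  have "summable (\<lambda>i. norm (b i))"
  proof (rule summable_comparison_test')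
    show "summable (\<lambda>i. norm q ^ i)" using q by (intro summable_geometric) auto
    fix i
    have "i \<le> k * i + i * (i + 1) div 2"
    proof (cases i)
      case (Suc n)
      then have "2 * i \<le> i * (i + 1)" by simp
      then show ?thesis by linarith
    qed simp
    then show "norm (norm (b i)) \<le> norm q ^ i"
      unfolding b_def using q by (auto simp: norm_mult norm_power intro!: power_decreasing)
  qed
  then have sm: "summable b" by (rule summable_norm_cancel)
  have "(\<lambda>M. - 1 + (1 + q ^ k) * (\<Sum>i<M. b i) + b M) \<longlonglongrightarrow> - 1 + (1 + q ^ k) * suminf b + 0"
    by (intro tendsto_intros summable_LIMSEQ sm summable_LIMSEQ_zero)
  then have "(\<lambda>m. kappa 1 q m * node 1 q m ^ k) sums (- 1 + (1 + q ^ k) * suminf b)"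
    unfolding sums_def sum_kappa_1 b_def by simp
  then show ?thesis using summable_sums[OF sm] unfolding b_def by (rule V_rhs_eq_if_sums[rotated])
qed

lemma summable_kappa_node:
  fixes q :: complex
  assumes q: "norm q < 1" and e: "e \<ge> 1"
  shows "summable (\<lambda>m. kappa e q m * node e q m ^ k)"
proof (rule summable_comparison_test')
  show "summable (\<lambda>m. 2 * norm q ^ m)" using q by (intro summable_mult summable_geometric) auto
  fix m
  have "norm (node e q m) ^ k \<le> 1"
    using norm_node_le[OF q, of e m] q by (intro power_le_one) auto
  then show "norm (kappa e q m * node e q m ^ k) \<le> 2 * norm q ^ m"
    unfolding norm_mult norm_power
    using mult_mono[OF norm_kappa_le[OF q e, of m]] by fastforce
qed

lemma tuple_sum_at_0:
  assumes "e \<ge> 1"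
  shows "tuple_sum s e j (0::complex) = (if j = 0 then 1 else 0)"
proof (cases j)
  case 0
  have "mono_tuples 0 = {[]}" by (auto simp: mono_tuples_def)
  then show ?thesis using 0 by (simp add: tuple_sum_def)
next
  case (Suc i)
  have "(\<Prod>n\<leftarrow>ns. weight s e (0::complex) (n - 1)) = 0" if "ns \<in> mono_tuples j" for ns
    using that Suc by (cases ns) (auto simp: mono_tuples_def weight_def node_def)
  then have "tuple_sum s e j (0::complex) = 0" unfolding tuple_sum_def by (rule infsum_0)
  then show ?thesis using Suc by simp
qed

text \<open>All weights vanish at q = 0, so the partial fractions break down there; both sides are
  evaluated directly, and only k = i = 0 contributes.\<close>

lemma series_at_0:
  assumes "e \<ge> 1"
  shows "(\<lambda>i. laurent_coeff s k (k + i) * tuple_sum s e (k + i) (0::complex)) sums series_rhs s e k 0"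
proof -
  have "qpoch 0 (0::complex) = (\<lambda>n. 1)" by (auto simp: qpoch_def)
  then have P: "qpoch_inf 0 (0::complex) = 1" by (simp add: qpoch_inf_def)
  have "kappa e 0 m * node e 0 m ^ k = (if m = 0 then if k = 0 then 1 else 0 else (0::complex))" for m
  proof (cases m)
    case (Suc n)
    then have "e * (m * (m + 1) div 2) \<noteq> 0" using assms by simp
    then have "(0::complex) ^ (e * (m * (m + 1) div 2)) = 0" unfolding power_eq_0_iff by blast
    then show ?thesis using Suc by (simp only: kappa_def) simp
  qed (use assms in \<open>auto simp: kappa_def node_def power_0_left\<close>)
  then have "(\<Sum>m. kappa e 0 m * node e (0::complex) m ^ k) = (if k = 0 then 1 else 0)"
    by (subst suminf_finite[of "{0}"]) auto
  then have R: "series_rhs s e k (0::complex) = (if k = 0 then 1 else 0)"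
    using assms P by (simp add: series_rhs_def power_0_left)
  have "laurent_coeff s k (k + i) * tuple_sum s e (k + i) (0::complex)
      = (if i = 0 then if k = 0 then 1 else 0 else 0)" for i
    by (simp add: tuple_sum_at_0[OF assms] laurent_coeff_def)
  then show ?thesis unfolding R
    using sums_single[of 0 "\<lambda>_. if k = 0 then 1 else (0::complex)"] by simp
qed

lemma series_complex:
  fixes q :: complex
  assumes q1: "norm q < 1" and s: "s = 1 \<or> s = -1" and e: "e = 1 \<or> e = 2"
    and sm: "summable (\<lambda>i. laurent_coeff s k (k + i) * tuple_sum s e (k + i) q)"
  shows "(\<Sum>i. laurent_coeff s k (k + i) * tuple_sum s e (k + i) q) = series_rhs s e k q"
proof (cases "q = 0")
  case True
  then show ?thesis using series_at_0[of e s k] e by (auto simp: sums_iff)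
next
  case False
  note ctx = False q1 s e
  have e1: "e \<ge> 1" using e by auto
  have lim: "weight s e q \<longlonglongrightarrow> 0"
    using summable_LIMSEQ_zero[OF summable_norm_weight[OF q1 e1 s]] tendsto_norm_zero_iff by blast
  have "(\<Sum>i. laurent_coeff s k (k + i) * tuple_sum s e (k + i) q) =
     (\<Sum>m. residue_coeff s e q m *
        (node e q m ^ k * (1 - of_int s * node e q m) ^ 2 / (1 - node e q m ^ 2)))"
    by (rule laurent_series_value[OF summable_residue_coeff[OF ctx] residue_coeff_nonzero[OF ctx]
          inj_weight[OF field_assms[OF ctx]] weight_nonzero[OF field_assms[OF ctx]] lim tuple_sum_eq[OF ctx]
          s sm norm_node_le[OF q1] q1 weight_def])
  also have "\<dots> = (\<Sum>m. qpoch_inf (of_int s * q) (q ^ e) ^ 2 / qpoch_inf (q ^ e) (q ^ e) ^ 2 *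
      (kappa e q m * node e q m ^ k))"
  proof (intro arg_cong[of _ _ suminf] ext)
    fix m
    have nz: "1 - node e q m ^ 2 \<noteq> 0" "1 - of_int s * node e q m \<noteq> 0"
      using node_mult_nonzero[OF field_assms[OF ctx], of m m] one_minus_node_nonzero[OF field_assms[OF ctx], of m]
      by (auto simp: power2_eq_square)
    then show "residue_coeff s e q m *
        (node e q m ^ k * (1 - of_int s * node e q m) ^ 2 / (1 - node e q m ^ 2)) =
      qpoch_inf (of_int s * q) (q ^ e) ^ 2 / qpoch_inf (q ^ e) (q ^ e) ^ 2 * (kappa e q m * node e q m ^ k)"
      unfolding residue_coeff_def lcoeff_inf_def by simp
  qed
  also have "\<dots> = series_rhs s e k q"
    unfolding series_rhs_def by (rule suminf_mult[OF summable_kappa_node[OF q1 e1]])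
  finally show ?thesis .
qed

text \<open>The expansion over m bounds the j-th tuple sum by K \<rho>^j, where \<rho> bounds all
  weights; the binomial adds at most 4^j, and 4 \<rho> < 1.\<close>

lemma summable_series_complex:
  fixes q :: complex
  assumes q: "norm q < 3 - 2 * sqrt 2" and s: "s = 1 \<or> s = -1" and e: "e = 1 \<or> e = 2"
  shows "summable (\<lambda>i. laurent_coeff s k (k + i) * tuple_sum s e (k + i) q)"
proof (cases "q = 0")
  case True
  then show ?thesis using series_at_0[of e s k] e by (auto simp: sums_iff)
next
  case False
  have "(1::real) < sqrt 2" by simp
  then have q1: "norm q < 1" using q by linarith
  note ctx = False q1 s e
  define \<rho> where "\<rho> = norm q / (1 - norm q) ^ 2"
  \<comment> \<open>With x = |q|, the inequality 8 < (3 - x)^2 rearranges to 4 x < (1 -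
    x)^2.\<close>
  have "(2 * sqrt 2) ^ 2 < (3 - norm q) ^ 2" using q by (intro power_strict_mono) auto
  then have "4 * norm q < (1 - norm q) ^ 2" by (simp add: power2_eq_square algebra_simps)
  then have \<rho>: "4 * \<rho> < 1" "\<rho> \<ge> 0" using q1 by (auto simp: \<rho>_def divide_simps)
  have a: "norm (weight s e q m) \<le> \<rho>" for m
    unfolding \<rho>_def
    by (rule order_trans[OF norm_weight_le[OF q1 s]]) (intro divide_right_mono norm_node_le q1, simp)
  define K where "K = (\<Sum>m. norm (residue_coeff s e q m))"
  have bound: "norm (tuple_sum s e j q) \<le> K * \<rho> ^ j" for j
  proof -
    have "norm (residue_coeff s e q m * weight s e q m ^ j) \<le> norm (residue_coeff s e q m) * \<rho> ^ j" for m
      unfolding norm_mult norm_power by (intro mult_left_mono power_mono a) auto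
    then have "norm (tuple_sum s e j q) \<le> (\<Sum>m. norm (residue_coeff s e q m) * \<rho> ^ j)"
      unfolding tuple_sum_eq[OF ctx]
      by (intro norm_suminf_le summable_mult2 summable_residue_coeff ctx)
    also have "\<dots> = K * \<rho> ^ j" unfolding K_def
      by (intro suminf_mult2[symmetric] summable_residue_coeff ctx)
    finally show ?thesis .
  qed
  show ?thesis
  proof (rule summable_comparison_test')
    show "summable (\<lambda>i. K * (4 * \<rho>) ^ k * (4 * \<rho>) ^ i)"
      using \<rho> by (intro summable_mult summable_geometric) auto
    fix i
    have "norm (laurent_coeff s k (k + i) * tuple_sum s e (k + i) q) \<le> 4 ^ (k + i) * (K * \<rho> ^ (k + i))"
      unfolding norm_mult by (intro mult_mono norm_laurent_coeff_le s bound) auto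
    then show "norm (laurent_coeff s k (k + i) * tuple_sum s e (k + i) q) \<le> K * (4 * \<rho>) ^ k * (4 * \<rho>) ^ i"
      by (simp add: power_mult_distrib power_add mult_ac)
  qed
qed

section \<open>Formal power series\<close>

text \<open>Congruence modulo X^(n+1). Every formal limit and infinite sum below is settled by
  showing that it is eventually constant modulo each such power.\<close>

definition fps_agree :: "nat \<Rightarrow> 'a::zero fps \<Rightarrow> 'a fps \<Rightarrow> bool" where
  "fps_agree n f g \<longleftrightarrow> (\<forall>i\<le>n. f $ i = g $ i)"

lemma fps_agree_refl [simp]: "fps_agree n f f"
  by (simp add: fps_agree_def)

lemma fps_agree_sym: "fps_agree n f g \<Longrightarrow> fps_agree n g f"
  by (simp add: fps_agree_def)

lemma fps_agree_trans: "fps_agree n f g \<Longrightarrow> fps_agree n g h \<Longrightarrow> fps_agree n f h"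
  by (simp add: fps_agree_def)

lemma fps_agree_nth: "fps_agree n f g \<Longrightarrow> f $ n = g $ n"
  by (simp add: fps_agree_def)

lemma fps_agree_add:
  "fps_agree n f f' \<Longrightarrow> fps_agree n g g' \<Longrightarrow> fps_agree n (f + g) (f' + (g' :: 'a::comm_ring_1 fps))"
  by (simp add: fps_agree_def)

lemma fps_agree_diff:
  "fps_agree n f f' \<Longrightarrow> fps_agree n g g' \<Longrightarrow> fps_agree n (f - g) (f' - (g' :: 'a::comm_ring_1 fps))"
  by (simp add: fps_agree_def)

lemma fps_agree_mult:
  "fps_agree n f f' \<Longrightarrow> fps_agree n g g' \<Longrightarrow> fps_agree n (f * g) (f' * (g' :: 'a::comm_ring_1 fps))"
  by (auto simp: fps_agree_def fps_mult_nth intro!: sum.cong)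

lemma fps_agree_power:
  "fps_agree n f f' \<Longrightarrow> fps_agree n (f ^ k) ((f' :: 'a::comm_ring_1 fps) ^ k)"
  by (induction k) (auto intro: fps_agree_mult)

lemma fps_agree_sum:
  "(\<And>x. x \<in> A \<Longrightarrow> fps_agree n (f x) (g x)) \<Longrightarrow> fps_agree n (sum f A) (sum g A :: 'a::comm_ring_1 fps)"
  by (auto simp: fps_agree_def fps_sum_nth intro!: sum.cong)

lemma fps_agree_divide:
  fixes f f' g g' :: "complex fps"
  assumes "fps_agree n f f'" "fps_agree n g g'" "g $ 0 \<noteq> 0"
  shows "fps_agree n (f / g) (f' / g')"
proof -
  have g'0: "g' $ 0 \<noteq> 0" using assms by (auto simp: fps_agree_def)
  have "fps_agree n (inverse g * (g * inverse g')) (inverse g * (g' * inverse g'))"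
    by (intro fps_agree_mult fps_agree_refl assms)
  then have "fps_agree n (inverse g) (inverse g')"
    using inverse_mult_eq_1[OF assms(3)] inverse_mult_eq_1'[OF g'0]
    by (simp add: mult.assoc[symmetric]) (rule fps_agree_sym)
  then show ?thesis
    using assms g'0 by (simp add: fps_divide_unit fps_agree_mult)
qed

lemma fps_agree_X_power: "n < k \<Longrightarrow> fps_agree n (fps_X ^ k * f) (0 :: 'a::comm_ring_1 fps)"
  by (simp add: fps_agree_def fps_X_power_mult_nth)

lemma fps_agree_zero_mult:
  "fps_agree n f 0 \<Longrightarrow> fps_agree n (f * g) (0 :: 'a::comm_ring_1 fps)"
  using fps_agree_mult[of n f 0 g g] by simp

text \<open>The assumption says that X^i divides \<open>f i\<close>, so each coefficient of the
  partial sums is eventually constant.\<close>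

lemma fps_sums_agree:
  fixes f :: "nat \<Rightarrow> complex fps"
  assumes "\<And>n i. n < i \<Longrightarrow> fps_agree n (f i) 0"
  shows "summable f" and "n < N \<Longrightarrow> fps_agree n (suminf f) (\<Sum>i<N. f i)"
proof -
  define L where "L = Abs_fps (\<lambda>n. (\<Sum>i<Suc n. f i) $ n)"
  have z: "f i $ n = 0" if "n < i" for i n using assms[OF that] by (simp add: fps_agree_def)
  have *: "(\<Sum>i<N. f i) $ n = L $ n" if "n < N" for n N
  proof -
    have "(\<Sum>i<Suc n. f i $ n) = (\<Sum>i<N. f i $ n)"
      by (rule sum.mono_neutral_left) (use that z in auto)
    then show ?thesis by (simp add: L_def fps_sum_nth)
  qed
  have "f sums L" unfolding sums_def
  proof (rule tendsto_fpsI)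
    show "\<forall>\<^sub>F N in sequentially. (\<Sum>i<N. f i) $ n = L $ n" for n
      using eventually_gt_at_top[of n] by eventually_elim (rule *)
  qed
  then show "summable f" by (rule sums_summable)
  have "suminf f = L" using \<open>f sums L\<close> by (rule sums_unique[symmetric])
  then show "fps_agree n (suminf f) (\<Sum>i<N. f i)" if "n < N"
    unfolding fps_agree_def using *[of _ N] that by simp
qed

section \<open>Truncation of the formal sums and products\<close>

abbreviation (input) X :: "complex fps" where "X \<equiv> fps_X"

lemma unit_nth_0: "(1 - of_int s * node e X i) $ 0 = 1"
  by (simp add: node_def)

lemma unit_square_nth_0: "((1 - of_int s * node e X i) ^ 2) $ 0 = 1"
  unfolding power2_eq_square fps_mult_nth_0 unit_nth_0 by simp

lemma weight_X_eq: "weight s e X i = X ^ (e * i + 1) * inverse ((1 - of_int s * node e X i) ^ 2)"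
  unfolding weight_def by (subst fps_divide_unit) (simp_all add: unit_square_nth_0 node_def)

lemma weight_X_mult: "(1 - of_int s * node e X i) ^ 2 * weight s e X i = node e X i"
proof -
  have "((1 - of_int s * node e X i) ^ 2) $ 0 \<noteq> 0" unfolding unit_square_nth_0 by simp
  from inverse_mult_eq_1[OF this] show ?thesis
    unfolding weight_X_eq by (simp add: node_def mult_ac)
qed

lemma weight_X_agree: "e \<ge> 1 \<Longrightarrow> n \<le> i \<Longrightarrow> fps_agree n (weight s e X i) 0"
proof -
  assume e: "e \<ge> 1" and n: "n \<le> i"
  have "1 * i \<le> e * i" using e by (rule mult_right_mono) simp
  then have "n < e * i + 1" using n by linarith
  then show ?thesis unfolding weight_X_eq by (rule fps_agree_X_power)
qed

lemma complete_hom_agree: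
  assumes e: "e \<ge> 1" and "n \<le> N"
  shows "fps_agree n (complete_hom (weight s e X) N j) (complete_hom (weight s e X) n j)"
  using assms(2)
proof (induction N rule: dec_induct)
  case (step N)
  have "fps_agree n (complete_hom (weight s e X) (Suc N) j) (complete_hom (weight s e X) N j)"
  proof (cases j)
    case (Suc i)
    then show ?thesis
      using fps_agree_add[OF fps_agree_refl fps_agree_zero_mult[OF weight_X_agree[OF e step(1)]],
          of "complete_hom (weight s e X) N j" s "complete_hom (weight s e X) (Suc N) i"] by simp
  qed simp
  then show ?case using step.IH by (rule fps_agree_trans)
qed simp

lemma complete_hom_scale:
  "complete_hom (\<lambda>i. c * w i) N j = c ^ j * complete_hom w N j"
  by (induction w N j rule: complete_hom.induct) (auto simp: algebra_simps)

text \<open>Each weight is divisible by X, and \<open>complete_hom\<close> is homogeneous of degree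
  j, hence divisible by X^j. This makes the formal series over j converge without
  restriction.\<close>

lemma complete_hom_X_low:
  assumes "n < j"
  shows "fps_agree n (complete_hom (weight s e X) N j) 0"
proof -
  have "weight s e X = (\<lambda>i. X * (X ^ (e * i) * inverse ((1 - of_int s * node e X i) ^ 2)))"
    by (simp add: weight_X_eq fun_eq_iff mult.assoc)
  then show ?thesis using fps_agree_X_power[OF assms] by (simp add: complete_hom_scale)
qed

lemma prod_list_agree:
  fixes f :: "nat \<Rightarrow> 'a::comm_ring_1 fps"
  assumes "m \<in> set ns" "fps_agree n (f m) 0"
  shows "fps_agree n (\<Prod>x\<leftarrow>ns. f x) 0"
  using assms
proof (induction ns)
  case (Cons x ns)
  show ?case
  proof (cases "m = x")
    case True
    then show ?thesis using Cons.prems by (simp add: fps_agree_zero_mult)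
  next
    case False
    then have "fps_agree n ((\<Prod>x\<leftarrow>ns. f x) * f x) 0" using Cons by (intro fps_agree_zero_mult) auto
    then show ?thesis by (simp add: mult.commute)
  qed
qed simp

text \<open>A tuple with an entry m > n involves the weight of index m - 1 \<ge> n, which is
  divisible by X^(n+1). Finite sums over any set of tuples containing
  \<open>bounded_tuples n k\<close> therefore have the same n-th coefficient.\<close>

lemma tuple_sum_agree:
  assumes e: "e \<ge> 1" and "n \<le> N"
  shows "fps_agree n (tuple_sum s e k X) (complete_hom (weight s e X) N k)"
proof -
  let ?f = "\<lambda>ns. \<Prod>x\<leftarrow>ns. weight s e X (x - 1)"
  define L where "L = Abs_fps (\<lambda>n. complete_hom (weight s e X) n k $ n)"
  have "(?f has_sum L) (mono_tuples k)"
    unfolding has_sum_def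
  proof (rule tendsto_fpsI)
    fix n
    have "sum ?f Y $ n = L $ n"
      if Y: "finite Y" "bounded_tuples n k \<subseteq> Y" "Y \<subseteq> mono_tuples k" for Y
    proof -
      have "?f ns $ n = 0" if "ns \<in> Y - bounded_tuples n k" for ns
      proof -
        from that Y obtain m where m: "m \<in> set ns" "m > n" by (force simp: bounded_tuples_def)
        then have "fps_agree n (weight s e X (m - 1)) 0" by (intro weight_X_agree e) auto
        from fps_agree_nth[OF prod_list_agree[OF m(1), of n "\<lambda>x. weight s e X (x - 1)", OF this]]
        show ?thesis by simp
      qed
      then have "sum ?f Y $ n = sum ?f (bounded_tuples n k) $ n"
        unfolding fps_sum_nth using Y by (intro sum.mono_neutral_right) auto
      then show ?thesis using sum_bounded_tuples[of "\<lambda>x. weight s e X (x - 1)" n k] by (simp add: L_def)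
    qed
    then show "\<forall>\<^sub>F Y in finite_subsets_at_top (mono_tuples k). sum ?f Y $ n = L $ n"
      unfolding eventually_finite_subsets_at_top
      by (intro exI[of _ "bounded_tuples n k"]) (simp add: finite_bounded_tuples bounded_tuples_subset)
  qed
  then have "tuple_sum s e k X = L" unfolding tuple_sum_def by (rule infsumI)
  moreover have "L $ i = complete_hom (weight s e X) N k $ i" if "i \<le> n" for i
    using fps_agree_nth[OF complete_hom_agree[OF e, of i N s k]] that assms(2) by (simp add: L_def)
  ultimately show ?thesis by (simp add: fps_agree_def)
qed

text \<open>The form \<open>X * c\<close> covers both first arguments that occur: c = s, and c =
  X^(e-1) for X^e. Factors from index n on are 1 modulo X^(n+1).\<close>

lemma qpoch_agree:
  assumes "e \<ge> 1" "n \<le> N" "n \<le> N'"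
  shows "fps_agree n (qpoch (X * c) (X ^ e) N) (qpoch (X * c) (X ^ e) N')"
proof -
  have *: "fps_agree n (qpoch (X * c) (X ^ e) N) (qpoch (X * c) (X ^ e) n)" if "n \<le> N" for N
    using that
  proof (induction N rule: dec_induct)
    case (step N)
    have "1 * N \<le> e * N" using assms(1) by (rule mult_right_mono) simp
    then have "fps_agree n (X ^ (e * N + 1) * c) 0" using step by (intro fps_agree_X_power) linarith
    then have "fps_agree n (qpoch (X * c) (X ^ e) N * (1 - X ^ (e * N + 1) * c)) (qpoch (X * c) (X ^ e) N * (1 - 0))"
      by (intro fps_agree_mult fps_agree_diff fps_agree_refl)
    moreover have "X * c * (X ^ e) ^ N = X ^ (e * N + 1) * c" by (simp add: mult_ac flip: power_mult)
    then have "qpoch (X * c) (X ^ e) (Suc N) = qpoch (X * c) (X ^ e) N * (1 - X ^ (e * N + 1) * c)"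
      unfolding qpoch_def prod.lessThan_Suc by (simp only:)
    ultimately have "fps_agree n (qpoch (X * c) (X ^ e) (Suc N)) (qpoch (X * c) (X ^ e) N)"
      by (simp only: diff_zero mult_1_right)
    then show ?case using step.IH by (rule fps_agree_trans)
  qed simp
  show ?thesis by (rule fps_agree_trans[OF *[OF assms(2)] fps_agree_sym[OF *[OF assms(3)]]])
qed

lemma qpoch_inf_agree:
  assumes "e \<ge> 1" "n \<le> N"
  shows "fps_agree n (qpoch_inf (X * c) (X ^ e)) (qpoch (X * c) (X ^ e) N)"
proof -
  define L where "L = Abs_fps (\<lambda>n. qpoch (X * c) (X ^ e) n $ n)"
  have L: "qpoch (X * c) (X ^ e) N $ n = L $ n" if "n \<le> N" for n N
    using fps_agree_nth[OF qpoch_agree[OF assms(1) that le_refl]] by (simp add: L_def)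
  have "qpoch (X * c) (X ^ e) \<longlonglongrightarrow> L"
  proof (rule tendsto_fpsI)
    show "\<forall>\<^sub>F N in sequentially. qpoch (X * c) (X ^ e) N $ n = L $ n" for n
      using eventually_ge_at_top[of n] by eventually_elim (rule L)
  qed
  then have "qpoch_inf (X * c) (X ^ e) = L" unfolding qpoch_inf_def by (rule limI)
  then show ?thesis using L assms(2) by (simp add: fps_agree_def)
qed

lemma kappa_X_agree:
  assumes "e \<ge> 1" "n < m"
  shows "fps_agree n (kappa e X m) 0"
proof -
  have "2 * m \<le> m * (m + 1)" using assms(2) by (cases m) auto
  then have "m \<le> m * (m + 1) div 2" by linarith
  then have "1 * m \<le> e * (m * (m + 1) div 2)" using assms(1) by (intro mult_mono) auto
  then have "fps_agree n (X ^ (e * (m * (m + 1) div 2)) * ((-1) ^ m * (if e = 1 then 1 - X ^ (m + 1) else 1))) 0"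
    using assms(2) by (intro fps_agree_X_power) simp
  then show ?thesis by (simp only: kappa_def mult_ac)
qed

lemma qpoch_X_nth_0: "qpoch (X * c) p N $ 0 = 1"
  by (induction N) (auto simp: qpoch_def)

section \<open>Transfer of the finite identity from complex to formal q\<close>

lemma has_fps_expansion_nat_power:
  fixes f :: "complex \<Rightarrow> complex"
  assumes "f has_fps_expansion F"
  shows "(\<lambda>x. f x ^ n) has_fps_expansion F ^ n"
  by (induction n) (auto intro!: has_fps_expansion_mult assms)

lemma has_fps_expansion_of_int: "(\<lambda>_. of_int s) has_fps_expansion (of_int s :: complex fps)"
  using has_fps_expansion_const[of "of_int s :: complex"] by (simp add: fps_of_int)

lemma has_fps_expansion_X: "(\<lambda>x. x) has_fps_expansion X"
  by (rule has_fps_expansion_fps_X)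

lemmas expansion_intros = has_fps_expansion_nat_power has_fps_expansion_of_int has_fps_expansion_X
  has_fps_expansion_1 has_fps_expansion_mult has_fps_expansion_diff has_fps_expansion_add
  has_fps_expansion_prod has_fps_expansion_sum has_fps_expansion_divide'

lemma node_expansion: "(\<lambda>q. node e q i) has_fps_expansion node e X i"
  unfolding node_def by (intro expansion_intros)

lemma weight_expansion: "(\<lambda>q. weight s e q i) has_fps_expansion weight s e X i"
  unfolding weight_def by (intro expansion_intros node_expansion) (simp only: unit_square_nth_0, simp)

lemma complete_hom_expansion:
  "(\<lambda>q. complete_hom (weight s e q) N j) has_fps_expansion complete_hom (weight s e X) N j"
proof (induction "weight s e X" N j rule: complete_hom.induct)
  case (3 N j)
  then show ?case by (simp add: has_fps_expansion_add has_fps_expansion_mult weight_expansion)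
qed auto

lemma qpoch_expansion:
  assumes "f has_fps_expansion F"
  shows "(\<lambda>q. qpoch (f q) (q ^ e) N) has_fps_expansion qpoch F (X ^ e) N"
  unfolding qpoch_def by (intro expansion_intros assms)

lemma kappa_expansion: "(\<lambda>q. kappa e q m) has_fps_expansion kappa e X m"
proof -
  have "(\<lambda>q. (if e = 1 then 1 - q ^ (m + 1) else 1)) has_fps_expansion (if e = 1 then 1 - X ^ (m + 1) else 1)"
  proof (cases "e = 1")
    case True
    have "(\<lambda>q. 1 - q ^ (m + 1)) has_fps_expansion (1 - X ^ (m + 1))" by (intro expansion_intros)
    then show ?thesis using True by simp
  qed simp
  moreover have "(\<lambda>_. -1) has_fps_expansion (-1 :: complex fps)"
    using has_fps_expansion_of_int[of "-1"] by simp
  ultimately show ?thesis unfolding kappa_def by (intro expansion_intros)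
qed

lemma X_power_eq_mult: "e \<ge> 1 \<Longrightarrow> X ^ e = X * X ^ (e - 1)"
  by (simp flip: power_Suc)

lemma qpoch_X_e_nth_0: "e \<ge> 1 \<Longrightarrow> qpoch (X ^ e) (X ^ e) N $ 0 = 1"
  using qpoch_X_nth_0[of "X ^ (e - 1)" "X ^ e" N] by (simp only: X_power_eq_mult[symmetric])

lemma lcoeff_expansion:
  assumes "e \<ge> 1"
  shows "(\<lambda>q. lcoeff s e N q m) has_fps_expansion lcoeff s e N X m"
  unfolding lcoeff_def
  by (intro expansion_intros kappa_expansion qpoch_expansion)
     (simp only: fps_mult_nth_0 qpoch_X_e_nth_0[OF assms], simp)

text \<open>The complex identities hold only for q \<noteq> 0; continuity closes the gap at 0, and
  functions equal near 0 have equal Taylor series.\<close>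

lemma fps_eq_if_punctured_eq:
  fixes F G :: "complex fps"
  assumes F: "f has_fps_expansion F" and G: "g has_fps_expansion G"
    and ev: "\<forall>\<^sub>F q in at 0. f q = g q"
  shows "F = G"
proof -
  have H: "(\<lambda>q. f q - g q) has_fps_expansion (F - G)" using F G by (rule has_fps_expansion_diff)
  have "isCont (\<lambda>q. f q - g q) 0" using has_fps_expansion_imp_continuous[OF H, of UNIV] by simp
  then have "(\<lambda>q. f q - g q) \<midarrow>0\<rightarrow> f 0 - g 0" by (rule isContD)
  moreover have "(\<lambda>q. f q - g q) \<midarrow>0\<rightarrow> 0"
    by (rule tendsto_eventually) (use ev in \<open>auto elim: eventually_mono\<close>)
  ultimately have "f 0 - g 0 = 0" by (rule LIM_unique)
  then have "\<forall>\<^sub>F q in nhds 0. f q = g q" using ev by (simp add: eventually_nhds_conv_at)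
  moreover have "\<forall>\<^sub>F q in nhds 0. eval_fps F q = f q" "\<forall>\<^sub>F q in nhds 0. eval_fps G q = g q"
    using F G by (auto simp: has_fps_expansion_def)
  ultimately have "\<forall>\<^sub>F q in nhds 0. eval_fps F q = eval_fps G q"
    by eventually_elim simp
  then show ?thesis using F G by (intro eval_fps_eqD) (auto simp: has_fps_expansion_def)
qed

text \<open>The complex identity holds on the punctured unit disc, and both sides are analytic at 0,
  because all denominators in this form have constant term 1.\<close>

lemma complete_hom_X:
  assumes s: "s = 1 \<or> s = -1" and e: "e = 1 \<or> e = 2" and N: "N \<ge> 1"
  shows "complete_hom (weight s e X) N j = (\<Sum>m<N. lcoeff s e N X m *
     ((1 - node e X m ^ 2) / (1 - of_int s * node e X m) ^ 2) * weight s e X m ^ j)"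
proof (rule fps_eq_if_punctured_eq[OF complete_hom_expansion])
  show "(\<lambda>q. \<Sum>m<N. lcoeff s e N q m *
     ((1 - node e q m ^ 2) / (1 - of_int s * node e q m) ^ 2) * weight s e q m ^ j) has_fps_expansion
     (\<Sum>m<N. lcoeff s e N X m *
     ((1 - node e X m ^ 2) / (1 - of_int s * node e X m) ^ 2) * weight s e X m ^ j)"
    by (intro expansion_intros lcoeff_expansion node_expansion weight_expansion)
       (use e in \<open>simp_all only: unit_square_nth_0, auto\<close>)
  have "\<forall>\<^sub>F q in at (0::complex). q \<in> ball 0 1 - {0}"
    by (rule eventually_at_in_open) auto
  then show "\<forall>\<^sub>F q in at (0::complex). complete_hom (weight s e q) N j = (\<Sum>m<N. lcoeff s e N q m *
     ((1 - node e q m ^ 2) / (1 - of_int s * node e q m) ^ 2) * weight s e q m ^ j)"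
  proof eventually_elim
    case (elim q)
    then have ctx: "q \<noteq> 0" "norm q < 1" by auto
    have "complete_hom (weight s e q) N j
        = (\<Sum>m<N. pf_coeff (weight s e q) N m * weight s e q m ^ j)"
      by (intro complete_hom_eq_sum_powers inj_weight[OF field_assms[OF ctx s e]]
          weight_nonzero[OF field_assms[OF ctx s e]] N)
    then show ?case by (simp add: pf_coeff_weight_eq[OF ctx s e])
  qed
qed

section \<open>Formal summation against the binomial coefficients\<close>

definition laurent_fps :: "int \<Rightarrow> nat \<Rightarrow> complex fps" where
  "laurent_fps s k = Abs_fps (laurent_coeff s k)"

lemma laurent_fps_0:
  assumes "s = 1 \<or> s = -1"
  shows "laurent_fps s 0 = 1 + X * (2 * laurent_fps s 1 - 2 * of_int s * laurent_fps s 0)"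
proof (rule fps_ext)
  fix n
  have 2: "(2 * f) $ i = 2 * f $ i" for f :: "complex fps" and i
    by (simp add: numeral_fps_const)
  show "laurent_fps s 0 $ n = (1 + X * (2 * laurent_fps s 1 - 2 * of_int s * laurent_fps s 0)) $ n"
    by (cases n) (simp_all add: laurent_fps_def laurent_coeff_0 laurent_coeff_0_Suc[OF assms] 2 mult.assoc)
qed

lemma laurent_fps_Suc:
  assumes "s = 1 \<or> s = -1"
  shows "laurent_fps s (Suc k) =
     X * (laurent_fps s k + laurent_fps s (Suc (Suc k)) - 2 * of_int s * laurent_fps s (Suc k))"
proof (rule fps_ext)
  fix n
  have 2: "(2 * f) $ i = 2 * f $ i" for f :: "complex fps" and i
    by (simp add: numeral_fps_const)
  show "laurent_fps s (Suc k) $ n =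
     (X * (laurent_fps s k + laurent_fps s (Suc (Suc k)) - 2 * of_int s * laurent_fps s (Suc k))) $ n"
    by (cases n) (simp_all add: laurent_fps_def laurent_coeff_0 laurent_coeff_Suc_Suc[OF assms] 2 mult.assoc)
qed

text \<open>Composition replaces convergence in j. The defect of the recurrence is divisible by the
  (n+1)-st power of the node for every n, so all its coefficients vanish.\<close>

lemma laurent_fps_compose_weight:
  assumes s: "s = 1 \<or> s = -1"
  shows "(1 - node e X m ^ 2) * (laurent_fps s k oo weight s e X m)
     = node e X m ^ k * (1 - of_int s * node e X m) ^ 2"
proof -
  let ?y = "node e X m" and ?A = "weight s e X m"
  define \<phi> where "\<phi> = (\<lambda>k. laurent_fps s k oo ?A)"
  have A0: "?A $ 0 = 0" by (simp add: weight_X_eq)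
  have const: "of_int c oo ?A = of_int c" "2 oo ?A = 2" for c
    by (simp_all add: fps_of_int[symmetric] numeral_fps_const)
  note comp = fps_compose_add_distrib fps_compose_sub_distrib fps_compose_mult_distrib[OF A0]
    fps_X_fps_compose_startby0[OF A0] const fps_compose_1
  have "\<phi> 0 = 1 + ?A * (2 * \<phi> 1 - 2 * of_int s * \<phi> 0)"
    unfolding \<phi>_def by (subst laurent_fps_0[OF s]) (simp only: comp)
  then have "(1 - of_int s * ?y) ^ 2 * \<phi> 0 = (1 - of_int s * ?y) ^ 2 * (1 + ?A * (2 * \<phi> 1 - 2 * of_int s * \<phi> 0))"
    by (rule arg_cong)
  then have h0: "(1 - of_int s * ?y) ^ 2 * \<phi> 0 = (1 - of_int s * ?y) ^ 2 + ?y * (2 * \<phi> 1 - 2 * of_int s * \<phi> 0)"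
    by (simp only: distrib_left mult.assoc[symmetric] weight_X_mult mult_1_right)
  have hS: "(1 - of_int s * ?y) ^ 2 * \<phi> (Suc k) = ?y * (\<phi> k + \<phi> (Suc (Suc k)) - 2 * of_int s * \<phi> (Suc k))" for k
  proof -
    have "\<phi> (Suc k) = ?A * (\<phi> k + \<phi> (Suc (Suc k)) - 2 * of_int s * \<phi> (Suc k))"
      unfolding \<phi>_def by (subst laurent_fps_Suc[OF s]) (simp only: comp)
    then have "(1 - of_int s * ?y) ^ 2 * \<phi> (Suc k) =
        (1 - of_int s * ?y) ^ 2 * (?A * (\<phi> k + \<phi> (Suc (Suc k)) - 2 * of_int s * \<phi> (Suc k)))"
      by (rule arg_cong)
    then show ?thesis by (simp only: mult.assoc[symmetric] weight_X_mult)
  qed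
  have geo: "\<phi> (Suc k) = ?y * \<phi> k" for k
  proof -
    have "(\<phi> (Suc k) - ?y * \<phi> k) $ n = 0" for n
    proof -
      have "?y ^ Suc n = X ^ ((e * m + 1) * Suc n)" unfolding node_def by (simp only: power_mult)
      moreover have "n < (e * m + 1) * Suc n" by simp
      ultimately show ?thesis
        unfolding recurrence_shift[OF s h0 hS, of k "Suc n"] by (simp only: fps_X_power_mult_nth if_True)
    qed
    then have "\<phi> (Suc k) - ?y * \<phi> k = 0" by (intro fps_ext) simp
    then show ?thesis by simp
  qed
  show ?thesis using recurrence_solution[OF s h0 hS geo, of k] by (simp add: \<phi>_def)
qed

lemma laurent_fps_compose_agree:
  assumes "A $ 0 = 0"
  shows "fps_agree n (laurent_fps s k oo A) (\<Sum>j\<le>n. fps_const (laurent_coeff s k j) * A ^ j)"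
  unfolding fps_agree_def
proof (intro allI impI)
  fix i assume "i \<le> n"
  have "(laurent_fps s k oo A) $ i = (\<Sum>j\<in>{0..i}. laurent_coeff s k j * (A ^ j) $ i)"
    by (simp add: fps_compose_nth laurent_fps_def)
  also have "\<dots> = (\<Sum>j\<le>n. laurent_coeff s k j * (A ^ j) $ i)"
    using \<open>i \<le> n\<close> startsby_zero_power_prefix[OF assms]
    by (intro sum.mono_neutral_left) auto
  finally show "(laurent_fps s k oo A) $ i = (\<Sum>j\<le>n. fps_const (laurent_coeff s k j) * A ^ j) $ i"
    by (simp add: fps_sum_nth)
qed

lemma laurent_coeff_fps: "(laurent_coeff s k j :: complex fps) = fps_const (laurent_coeff s k j)"
  unfolding laurent_coeff_def fps_of_int[symmetric] fps_of_nat[symmetric] by simp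

text \<open>Cutting the sum at j = n is harmless modulo X^(n+1), as the weights have no constant
  term. For each m the generating function then cancels (1 - y^2) / (1 - s y)^2 and leaves
  y^k.\<close>

lemma sum_laurent_complete_hom_agree:
  assumes s: "s = 1 \<or> s = -1" and e: "e = 1 \<or> e = 2" and N: "N \<ge> 1"
  shows "fps_agree n (\<Sum>j\<le>n. fps_const (laurent_coeff s k j) * complete_hom (weight s e X) N j)
     (\<Sum>m<N. lcoeff s e N X m * node e X m ^ k)"
proof -
  let ?y = "node e X" and ?A = "weight s e X"
  define c where "c = (\<lambda>m. (1 - ?y m ^ 2) / (1 - of_int s * ?y m) ^ 2)"
  have "(\<Sum>j\<le>n. fps_const (laurent_coeff s k j) * complete_hom ?A N j)
      = (\<Sum>m<N. lcoeff s e N X m * c m * (\<Sum>j\<le>n. fps_const (laurent_coeff s k j) * ?A m ^ j))"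
    unfolding complete_hom_X[OF s e N] c_def sum_distrib_left
    by (subst sum.swap) (simp add: mult_ac)
  moreover have "fps_agree n \<dots> (\<Sum>m<N. lcoeff s e N X m * c m * (laurent_fps s k oo ?A m))"
    by (intro fps_agree_sum fps_agree_mult fps_agree_refl fps_agree_sym[OF laurent_fps_compose_agree])
       (simp add: weight_X_eq)
  moreover have "c m * (laurent_fps s k oo ?A m) = ?y m ^ k" for m
  proof -
    have u: "((1 - of_int s * ?y m) ^ 2) $ 0 \<noteq> 0" unfolding unit_square_nth_0 by simp
    have "c m * (laurent_fps s k oo ?A m)
        = inverse ((1 - of_int s * ?y m) ^ 2) * ((1 - ?y m ^ 2) * (laurent_fps s k oo ?A m))"
      unfolding c_def fps_divide_unit[OF u] by (simp only: mult_ac)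
    also have "\<dots> = ?y m ^ k * (inverse ((1 - of_int s * ?y m) ^ 2) * (1 - of_int s * ?y m) ^ 2)"
      unfolding laurent_fps_compose_weight[OF s] by (simp only: mult_ac)
    finally show ?thesis unfolding inverse_mult_eq_1[OF u] by simp
  qed
  ultimately show ?thesis by (simp add: mult.assoc)
qed

lemma lcoeff_sum_agree:
  assumes e: "e = 1 \<or> e = 2"
  shows "fps_agree n (\<Sum>m<2 * n + 2. lcoeff s e (2 * n + 2) X m * node e X m ^ k) (series_rhs s e k X)"
proof -
  \<comment> \<open>Large enough that N - 1 - m \<ge> n for all m \<le> n, so both Pochhammer
    denominators agree with the infinite product modulo X^(n+1); for m > n already
    \<open>kappa\<close> vanishes to that order.\<close>
  let ?N = "2 * n + 2"
  have e1: "e \<ge> 1" using e by auto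
  define P where "P = qpoch_inf (of_int s * X) (X ^ e)"
  define Q where "Q = qpoch_inf (X ^ e) (X ^ e)"
  have Pa: "fps_agree n P (qpoch (of_int s * X) (X ^ e) M)" if "n \<le> M" for M
    using qpoch_inf_agree[OF e1 that, of "of_int s"] by (simp add: P_def mult.commute)
  have Qa: "fps_agree n Q (qpoch (X ^ e) (X ^ e) M)" if "n \<le> M" for M
    using qpoch_inf_agree[OF e1 that, of "X ^ (e - 1)"] unfolding Q_def X_power_eq_mult[OF e1, symmetric] .
  have Q0: "Q $ 0 = 1"
    using Qa[of n] qpoch_X_e_nth_0[OF e1, of n] by (auto simp: fps_agree_def)
  then have Q20: "(Q ^ 2) $ 0 \<noteq> 0" by (simp add: power2_eq_square)
  have lcoeff: "fps_agree n (lcoeff s e ?N X m) (P ^ 2 / Q ^ 2 * kappa e X m)" if "m < ?N" for m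
  proof (cases "m \<le> n")
    case True
    have "fps_agree n (P ^ 2 * kappa e X m / (Q * Q)) (lcoeff s e ?N X m)"
      unfolding lcoeff_def
      by (intro fps_agree_divide fps_agree_mult fps_agree_power fps_agree_refl Pa Qa)
         (use True e Q20 in \<open>auto simp: power2_eq_square\<close>)
    moreover have "P ^ 2 * kappa e X m / (Q * Q) = P ^ 2 / Q ^ 2 * kappa e X m"
      using Q20 by (simp add: fps_divide_unit power2_eq_square mult_ac)
    ultimately show ?thesis using fps_agree_sym by simp
  next
    case False
    then have k0: "fps_agree n (kappa e X m) 0" by (intro kappa_X_agree e1) simp
    let ?D = "qpoch (X ^ e) (X ^ e) (?N - 1 - m) * qpoch (X ^ e) (X ^ e) (?N + m + 2 - e)"
    have D0: "?D $ 0 \<noteq> 0" by (simp only: fps_mult_nth_0 qpoch_X_e_nth_0[OF e1]) simp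
    have "lcoeff s e ?N X m = kappa e X m * (qpoch (of_int s * X) (X ^ e) ?N ^ 2 * inverse ?D)"
      unfolding lcoeff_def fps_divide_unit[OF D0] by (simp only: mult_ac)
    then have "fps_agree n (lcoeff s e ?N X m) 0" using fps_agree_zero_mult[OF k0] by simp
    moreover have "fps_agree n (P ^ 2 / Q ^ 2 * kappa e X m) 0"
      using fps_agree_zero_mult[OF k0, of "P ^ 2 / Q ^ 2"] by (simp add: mult.commute)
    ultimately show ?thesis by (rule fps_agree_trans[OF _ fps_agree_sym])
  qed
  have "fps_agree n (\<Sum>m<?N. lcoeff s e ?N X m * node e X m ^ k)
       (\<Sum>m<?N. P ^ 2 / Q ^ 2 * kappa e X m * node e X m ^ k)"
    by (intro fps_agree_sum fps_agree_mult lcoeff) auto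
  also have "(\<Sum>m<?N. P ^ 2 / Q ^ 2 * kappa e X m * node e X m ^ k)
      = P ^ 2 / Q ^ 2 * (\<Sum>m<?N. kappa e X m * node e X m ^ k)"
    by (simp only: sum_distrib_left mult.assoc)
  finally have 1: "fps_agree n (\<Sum>m<?N. lcoeff s e ?N X m * node e X m ^ k)
     (P ^ 2 / Q ^ 2 * (\<Sum>m<?N. kappa e X m * node e X m ^ k))" .
  have "fps_agree n (suminf (\<lambda>m. kappa e X m * node e X m ^ k)) (\<Sum>m<?N. kappa e X m * node e X m ^ k)"
    by (rule fps_sums_agree(2)) (auto intro!: fps_agree_zero_mult kappa_X_agree e1)
  then have "fps_agree n (series_rhs s e k X) (P ^ 2 / Q ^ 2 * (\<Sum>m<?N. kappa e X m * node e X m ^ k))"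
    unfolding series_rhs_def P_def[symmetric] Q_def[symmetric]
    by (intro fps_agree_mult fps_agree_refl)
  from fps_agree_trans[OF 1 fps_agree_sym[OF this]] show ?thesis .
qed

lemma series_fps:
  assumes s: "s = 1 \<or> s = -1" and e: "e = 1 \<or> e = 2"
  shows "(\<lambda>i. laurent_coeff s k (k + i) * tuple_sum s e (k + i) X) sums series_rhs s e k X"
proof -
  have e1: "e \<ge> 1" using e by auto
  let ?t = "\<lambda>i. laurent_coeff s k (k + i) * tuple_sum s e (k + i) X"
  have low: "fps_agree n (tuple_sum s e j X) 0" if "n < j" for n j
    using tuple_sum_agree[OF e1 le_refl] complete_hom_X_low[OF that] by (rule fps_agree_trans)
  have tlow: "fps_agree n (?t i) 0" if "n < i" for n i
    using fps_agree_zero_mult[OF low[of n "k + i"]] that by (simp add: mult.commute)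
  have sm: "summable ?t" "n < N \<Longrightarrow> fps_agree n (suminf ?t) (\<Sum>i<N. ?t i)" for n N
    by (rule fps_sums_agree, erule tlow, assumption?)+
  have "suminf ?t = series_rhs s e k X"
  proof (rule fps_ext)
    fix n :: nat
    let ?N = "2 * n + 2"
    have "suminf ?t $ n = (\<Sum>i<Suc n. ?t i) $ n" using sm(2)[of n "Suc n"] by (simp add: fps_agree_nth)
    also have "\<dots> = (\<Sum>i<Suc n. laurent_coeff s k (k + i) * tuple_sum s e (k + i) X $ n)"
      by (simp add: fps_sum_nth laurent_coeff_fps)
    also have "\<dots> = (\<Sum>j\<in>{k..<k + Suc n}. laurent_coeff s k j * tuple_sum s e j X $ n)"
      by (rule sum.reindex_bij_witness[of _ "\<lambda>j. j - k" "\<lambda>i. k + i"]) auto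
    \<comment> \<open>Terms with j < k may be added, since \<open>laurent_coeff\<close> is 0 there;
      afterwards terms with j > n are dropped, since X^j divides the tuple sum.\<close>
    also have "\<dots> = (\<Sum>j<k + Suc n. laurent_coeff s k j * tuple_sum s e j X $ n)"
      by (rule sum.mono_neutral_left) (auto simp: laurent_coeff_def)
    also have "\<dots> = (\<Sum>j\<le>n. laurent_coeff s k j * tuple_sum s e j X $ n)"
    proof (rule sum.mono_neutral_right)
      show "\<forall>j\<in>{..<k + Suc n} - {..n}. laurent_coeff s k j * tuple_sum s e j X $ n = 0"
        using fps_agree_nth[OF low[of n]] by auto
    qed auto
    also have "\<dots> = (\<Sum>j\<le>n. fps_const (laurent_coeff s k j) * complete_hom (weight s e X) ?N j) $ n"
      using fps_agree_nth[OF tuple_sum_agree[OF e1, of n ?N]] by (simp add: fps_sum_nth)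
    also have "\<dots> = (\<Sum>m<?N. lcoeff s e ?N X m * node e X m ^ k) $ n"
      by (rule fps_agree_nth[OF sum_laurent_complete_hom_agree[OF s e]]) simp
    also have "\<dots> = series_rhs s e k X $ n"
      by (rule fps_agree_nth[OF lcoeff_sum_agree[OF e]])
    finally show "suminf ?t $ n = series_rhs s e k X $ n" .
  qed
  then show ?thesis using summable_sums[OF sm(1)] by simp
qed

lemma V_rhs_fps: "V_rhs s k X = series_rhs s 1 k X"
proof -
  define b where "b = (\<lambda>i. (-1) ^ i * X ^ (k * i + i * (i + 1) div 2))"
  have blow: "fps_agree n (b i) 0" if "n < i" for n i
  proof -
    have "2 * i \<le> i * (i + 1)" using that by (cases i) auto
    then have "i \<le> i * (i + 1) div 2" by linarith
    then have "n < k * i + i * (i + 1) div 2" using that by linarith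
    from fps_agree_X_power[OF this, of "(-1) ^ i"] show ?thesis by (simp add: b_def mult.commute)
  qed
  have klow: "fps_agree n (kappa 1 X m * node 1 X m ^ k) 0" if "n < m" for n m
    by (intro fps_agree_zero_mult kappa_X_agree that) simp
  let ?\<kappa> = "\<lambda>m. kappa 1 X m * node 1 X m ^ k"
  have sb: "summable b" "n < N \<Longrightarrow> fps_agree n (suminf b) (\<Sum>i<N. b i)" for n N
    by (rule fps_sums_agree, erule blow, assumption?)+
  have sk: "summable ?\<kappa>" "n < N \<Longrightarrow> fps_agree n (suminf ?\<kappa>) (\<Sum>m<N. ?\<kappa> m)" for n N
    by (rule fps_sums_agree, erule klow, assumption?)+
  have "suminf (\<lambda>m. kappa 1 X m * node 1 X m ^ k) = - 1 + (1 + X ^ k) * suminf b"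
  proof (rule fps_ext)
    fix n
    have "fps_agree n (suminf (\<lambda>m. kappa 1 X m * node 1 X m ^ k)) (- 1 + (1 + X ^ k) * (\<Sum>i<Suc n. b i) + b (Suc n))"
      using sk(2)[OF lessI, of n] unfolding sum_kappa_1 b_def by simp
    moreover have "fps_agree n (- 1 + (1 + X ^ k) * suminf b + 0) (- 1 + (1 + X ^ k) * (\<Sum>i<Suc n. b i) + b (Suc n))"
      by (intro fps_agree_add fps_agree_mult fps_agree_refl sb(2) fps_agree_sym[OF blow]) auto
    ultimately show "suminf (\<lambda>m. kappa 1 X m * node 1 X m ^ k) $ n = (- 1 + (1 + X ^ k) * suminf b) $ n"
      by (simp add: fps_agree_def)
  qed
  then have "(\<lambda>m. kappa 1 X m * node 1 X m ^ k) sums (- 1 + (1 + X ^ k) * suminf b)"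
    using summable_sums[OF sk(1)] by simp
  then show ?thesis
    using summable_sums[OF sb(1)] unfolding b_def by (rule V_rhs_eq_if_sums[rotated])
qed

text \<open>Convergence cannot be asserted for all |q| < 1: for s = 1 and real q between 3 - 2 sqrt
  2 and 1 the first weight exceeds 1/4, and \<open>weights_le_quarter\<close> excludes convergence;
  for s = -1 the same happens at -q. Hence the identity is stated wherever the series converges,
  with a disc on which it does, and unconditionally for formal q.\<close>

theorem theorem3:
  fixes k :: nat and s :: int
  assumes "s = 1 \<or> s = - 1"
  shows
    "(\<forall>q::complex. norm q < 1 \<longrightarrow>
        (summable (\<lambda>i. V_term s k q (k + i)) \<longrightarrow>
          (\<Sum>i. V_term s k q (k + i)) = V_rhs s k q) \<and>
        (summable (\<lambda>i. W_term s k q (k + i)) \<longrightarrow>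
          (\<Sum>i. W_term s k q (k + i)) = W_rhs s k q)) \<and>
     (\<forall>q::complex. norm q < 3 - 2 * sqrt 2 \<longrightarrow>
        summable (\<lambda>i. V_term s k q (k + i)) \<and>
        summable (\<lambda>i. W_term s k q (k + i))) \<and>
     (\<lambda>i. V_term s k (fps_X :: complex fps) (k + i)) sums V_rhs s k fps_X \<and>
     (\<lambda>i. W_term s k (fps_X :: complex fps) (k + i)) sums W_rhs s k fps_X"
proof (intro conjI allI impI)
  fix q :: complex assume q: "norm q < 1"
  show "(\<Sum>i. V_term s k q (k + i)) = V_rhs s k q" if "summable (\<lambda>i. V_term s k q (k + i))"
    using series_complex[OF q assms, of 1 k] that unfolding V_term_eq V_rhs_eq[OF q] by blast
  show "(\<Sum>i. W_term s k q (k + i)) = W_rhs s k q" if "summable (\<lambda>i. W_term s k q (k + i))"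
    using series_complex[OF q assms, of 2 k] that unfolding W_term_eq W_rhs_eq by blast
next
  fix q :: complex assume q: "norm q < 3 - 2 * sqrt 2"
  show "summable (\<lambda>i. V_term s k q (k + i))" "summable (\<lambda>i. W_term s k q (k + i))"
    unfolding V_term_eq W_term_eq by (intro summable_series_complex q assms; simp)+
next
  show "(\<lambda>i. V_term s k X (k + i)) sums V_rhs s k X"
    unfolding V_term_eq V_rhs_fps by (rule series_fps[OF assms]) simp
  show "(\<lambda>i. W_term s k X (k + i)) sums W_rhs s k X"
    unfolding W_term_eq W_rhs_eq by (rule series_fps[OF assms]) simp
qed

end
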